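(* Let $(G,\mathfrak{B})$ be a Rota-Baxter Lie group with pair-weight $(\Phi,\Psi)$, where the pair $(\Phi,\Psi)$ is unital, and let $\mathfrak{g}=T_eG$ be the Lie algebra of $G$. Let the linear operators $B:=\mathfrak{B}_{*e}$, $\phi:=\Phi_{*e}$, $\psi:=\Psi_{*e}$ on $\mathfrak{g}$ be the tangent maps of $\mathfrak{B}$, $\Phi$ and $\Psi$ at the identity $e$, respectively. Then $(\mathfrak{g},B)$ is a Rota-Baxter Lie algebra with pair-weight $(\phi,\psi)$.
   Context: Groups: let $G$ be a group with identity $e$ and $\Phi,\Psi:G\to G$ maps. $G$ is a $(\Phi,\Psi)$-group if $\Phi\circ\Psi=\mathrm{id}_G$. For a $(\Phi,\Psi)$-group $G$, a map $\mathfrak{B}:G\to G$ is a Rota-Baxter operator with pair-weight $(\Phi,\Psi)$ if $$\mathfrak{B}(a)\mathfrak{B}(b)=\mathfrak{B}\Big(\Psi\big(\Phi(a)\,\mathfrak{B}(a)\,\Phi(b)\,\mathfrak{B}(a)^{-1}\big)\Big),\quad a,b\in G.$$ A Rota-Baxter Lie group with pair-weight $(\Phi,\Psi)$ is such a pair $(G,\mathfrak{B})$ where $G$ is a Lie group and $\Phi,\Psi,\mathfrak{B}$ are smooth. The pair $(\Phi,\Psi)$ is unital if $\Phi(e)=\Psi(e)=e$. Lie algebras: let $\mathfrak{g}$ be a Lie algebra and $\phi,\psi,B:\mathfrak{g}\to\mathfrak{g}$ linear maps. $\mathfrak{g}$ is a $(\phi,\psi)$-Lie algebra if $\phi\circ\psi=\mathrm{id}_{\mathfrak{g}}$.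 A Rota-Baxter Lie algebra with pair-weight $(\phi,\psi)$ is a $(\phi,\psi)$-Lie algebra $\mathfrak{g}$ with a linear operator $B$ such that $$[B(u),B(v)]=B\Big(\psi\big([B(u),\phi(v)]+[\phi(u),B(v)]+[\phi(u),\phi(v)]\big)\Big),\quad u,v\in\mathfrak{g}.$$ *)

theory Defs
  imports "HOL-Analysis.Analysis" "HOL-Algebra.Module"
begin

section \<open>Smooth maps between open sets of normed spaces\<close>

text \<open>Iterated directional derivatives. On an open subset of a finite-dimensional space this is
  the usual notion of a \<open>C\<^sup>k\<close> map; it is applied to open sets and finite-dimensional spaces only.\<close>

primrec Ck_on ::
    "nat \<Rightarrow> 'e::real_normed_vector set \<Rightarrow> ('e \<Rightarrow> 'f::real_normed_vector) \<Rightarrow> bool" where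
  "Ck_on 0 S f \<longleftrightarrow> continuous_on S f"
| "Ck_on (Suc k) S f \<longleftrightarrow>
     (\<forall>x\<in>S. f differentiable (at x)) \<and> (\<forall>v. Ck_on k S (\<lambda>x. frechet_derivative f (at x) v))"

definition smooth_on ::
    "'e::real_normed_vector set \<Rightarrow> ('e \<Rightarrow> 'f::real_normed_vector) \<Rightarrow> bool" where
  "smooth_on S f \<longleftrightarrow> (\<forall>k. Ck_on k S f)"


section \<open>Smooth manifolds\<close>

text \<open>The model space is a finite-dimensional real normed space rather than a type of class
  \<open>euclidean_space\<close>, because the latter excludes dimension 0. The atlas need not be maximal.\<close>

record ('a, 'e) mfd =
  mtop :: "'a topology"
  atlas :: "('a set \<times> ('a \<Rightarrow> 'e)) set"

definition smooth_manifold :: "('a, 'e::real_normed_vector) mfd \<Rightarrow> bool" where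
  "smooth_manifold M \<longleftrightarrow>
     (\<exists>E::'e set. finite E \<and> span E = UNIV) \<and>
     Hausdorff_space (mtop M) \<and> second_countable (mtop M) \<and>
     \<Union> (fst ` atlas M) = topspace (mtop M) \<and>
     (\<forall>(U, c) \<in> atlas M. openin (mtop M) U \<and> open (c ` U) \<and>
        homeomorphic_map (subtopology (mtop M) U) (top_of_set (c ` U)) c) \<and>
     (\<forall>(U, c) \<in> atlas M. \<forall>(V, d) \<in> atlas M. smooth_on (c ` (U \<inter> V)) (d \<circ> inv_into U c))"

definition vec_mfd :: "('e::real_normed_vector, 'e) mfd" where
  "vec_mfd = \<lparr>mtop = euclidean, atlas = {(UNIV, id)}\<rparr>"

definition prod_mfd ::
    "('a, 'e) mfd \<Rightarrow> ('b, 'f) mfd \<Rightarrow> ('a \<times> 'b, 'e \<times> 'f) mfd" where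
  "prod_mfd M N =
     \<lparr>mtop = prod_topology (mtop M) (mtop N),
      atlas = {(U \<times> V, map_prod c d) | U c V d. (U, c) \<in> atlas M \<and> (V, d) \<in> atlas N}\<rparr>"

definition smooth_map_on ::
    "'a set \<Rightarrow> ('a, 'e::real_normed_vector) mfd \<Rightarrow> ('b, 'f::real_normed_vector) mfd
      \<Rightarrow> ('a \<Rightarrow> 'b) \<Rightarrow> bool" where
  "smooth_map_on W M N F \<longleftrightarrow>
     openin (mtop M) W \<and> continuous_map (subtopology (mtop M) W) (mtop N) F \<and>
     (\<forall>(U, c) \<in> atlas M. \<forall>(V, d) \<in> atlas N.
        smooth_on (c ` (W \<inter> U \<inter> F -` V)) (d \<circ> F \<circ> inv_into U c))"

abbreviation smooth_map ::
    "('a, 'e::real_normed_vector) mfd \<Rightarrow> ('b, 'f::real_normed_vector) mfd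
      \<Rightarrow> ('a \<Rightarrow> 'b) \<Rightarrow> bool" where
  "smooth_map M N F \<equiv> smooth_map_on (topspace (mtop M)) M N F"


section \<open>Tangent vectors\<close>

definition smooth_fun_near ::
    "('a, 'e::real_normed_vector) mfd \<Rightarrow> 'a \<Rightarrow> ('a \<Rightarrow> real) \<Rightarrow> bool" where
  "smooth_fun_near M p f \<longleftrightarrow> (\<exists>W. p \<in> W \<and> smooth_map_on W M vec_mfd f)"

definition smooth_curve_at ::
    "('a, 'e::real_normed_vector) mfd \<Rightarrow> 'a \<Rightarrow> (real \<Rightarrow> 'a) \<Rightarrow> bool" where
  "smooth_curve_at M p \<gamma> \<longleftrightarrow> \<gamma> 0 = p \<and> (\<exists>J. 0 \<in> J \<and> smooth_map_on J vec_mfd M \<gamma>)"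

text \<open>Two curves through \<open>p\<close> have the same velocity iff \<open>(f \<circ> \<gamma>)'(0)\<close> agrees for all real functions
  \<open>f\<close> that are smooth near \<open>p\<close>, so a velocity is represented by the functional \<open>f \<mapsto> (f \<circ> \<gamma>)'(0)\<close>.
  All functionals are set to 0 on functions that are not smooth near the base point, to make the
  representation unique.\<close>

type_synonym 'a tangent = "('a \<Rightarrow> real) \<Rightarrow> real"

definition velocity ::
    "('a, 'e::real_normed_vector) mfd \<Rightarrow> 'a \<Rightarrow> (real \<Rightarrow> 'a) \<Rightarrow> 'a tangent" where
  "velocity M p \<gamma> = (\<lambda>f. if smooth_fun_near M p f then deriv (\<lambda>t. f (\<gamma> t)) 0 else 0)"

definition tangent_space ::
    "('a, 'e::real_normed_vector) mfd \<Rightarrow> 'a \<Rightarrow> 'a tangent set" where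
  "tangent_space M p = {velocity M p \<gamma> | \<gamma>. smooth_curve_at M p \<gamma>}"

text \<open>Here \<open>N\<close> is the target manifold of \<open>F\<close>; the functionals do not refer to the source.\<close>

definition tangent_map ::
    "('b, 'f::real_normed_vector) mfd \<Rightarrow> 'a \<Rightarrow> ('a \<Rightarrow> 'b) \<Rightarrow> 'a tangent \<Rightarrow> 'b tangent" where
  "tangent_map N p F u = (\<lambda>f. if smooth_fun_near N (F p) f then u (f \<circ> F) else 0)"

text \<open>The value at \<open>p\<close> of the commutator \<open>XY - YX\<close> of two vector fields.\<close>

definition vf_bracket ::
    "('a, 'e::real_normed_vector) mfd \<Rightarrow> ('a \<Rightarrow> 'a tangent) \<Rightarrow> ('a \<Rightarrow> 'a tangent)
      \<Rightarrow> 'a \<Rightarrow> 'a tangent" where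
  "vf_bracket M X Y p =
     (\<lambda>f. if smooth_fun_near M p f then X p (\<lambda>q. Y q f) - Y p (\<lambda>q. X q f) else 0)"


section \<open>Lie algebras\<close>

record ('r, 'v) lie_alg = "('r, 'v) module" +
  lie_br :: "'v \<Rightarrow> 'v \<Rightarrow> 'v"

text \<open>The fields \<open>mult\<close> and \<open>one\<close> that records for modules inherit from rings play no role.\<close>

definition lie_algebra :: "('r, 'm) ring_scheme \<Rightarrow> ('r, 'v) lie_alg \<Rightarrow> bool" where
  "lie_algebra R L \<longleftrightarrow> Ring.field R \<and> Module.module R L \<and>
     (\<forall>u\<in>carrier L. \<forall>v\<in>carrier L. lie_br L u v \<in> carrier L) \<and>
     (\<forall>u\<in>carrier L. \<forall>v\<in>carrier L. \<forall>w\<in>carrier L.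
        lie_br L (u \<oplus>\<^bsub>L\<^esub> v) w = lie_br L u w \<oplus>\<^bsub>L\<^esub> lie_br L v w \<and>
        lie_br L u (v \<oplus>\<^bsub>L\<^esub> w) = lie_br L u v \<oplus>\<^bsub>L\<^esub> lie_br L u w) \<and>
     (\<forall>r\<in>carrier R. \<forall>u\<in>carrier L. \<forall>v\<in>carrier L.
        lie_br L (r \<odot>\<^bsub>L\<^esub> u) v = r \<odot>\<^bsub>L\<^esub> lie_br L u v \<and>
        lie_br L u (r \<odot>\<^bsub>L\<^esub> v) = r \<odot>\<^bsub>L\<^esub> lie_br L u v) \<and>
     (\<forall>u\<in>carrier L. lie_br L u u = \<zero>\<^bsub>L\<^esub>) \<and>
     (\<forall>u\<in>carrier L. \<forall>v\<in>carrier L. \<forall>w\<in>carrier L.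
        lie_br L u (lie_br L v w) \<oplus>\<^bsub>L\<^esub> lie_br L v (lie_br L w u) \<oplus>\<^bsub>L\<^esub> lie_br L w (lie_br L u v)
          = \<zero>\<^bsub>L\<^esub>)"

definition linear_operator ::
    "('r, 'm) ring_scheme \<Rightarrow> ('r, 'v) lie_alg \<Rightarrow> ('v \<Rightarrow> 'v) \<Rightarrow> bool" where
  "linear_operator R L T \<longleftrightarrow> T \<in> carrier L \<rightarrow> carrier L \<and>
     (\<forall>u\<in>carrier L. \<forall>v\<in>carrier L. T (u \<oplus>\<^bsub>L\<^esub> v) = T u \<oplus>\<^bsub>L\<^esub> T v) \<and>
     (\<forall>r\<in>carrier R. \<forall>u\<in>carrier L. T (r \<odot>\<^bsub>L\<^esub> u) = r \<odot>\<^bsub>L\<^esub> T u)"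

definition pair_lie_algebra ::
    "('r, 'm) ring_scheme \<Rightarrow> ('r, 'v) lie_alg \<Rightarrow> ('v \<Rightarrow> 'v) \<Rightarrow> ('v \<Rightarrow> 'v) \<Rightarrow> bool" where
  "pair_lie_algebra R L \<phi> \<psi> \<longleftrightarrow> lie_algebra R L \<and>
     linear_operator R L \<phi> \<and> linear_operator R L \<psi> \<and> (\<forall>u\<in>carrier L. \<phi> (\<psi> u) = u)"

definition rota_baxter_lie_algebra ::
    "('r, 'm) ring_scheme \<Rightarrow> ('r, 'v) lie_alg \<Rightarrow> ('v \<Rightarrow> 'v) \<Rightarrow> ('v \<Rightarrow> 'v)
      \<Rightarrow> ('v \<Rightarrow> 'v) \<Rightarrow> bool" where
  "rota_baxter_lie_algebra R L \<phi> \<psi> B \<longleftrightarrow> pair_lie_algebra R L \<phi> \<psi> \<and> linear_operator R L B \<and>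
     (\<forall>u\<in>carrier L. \<forall>v\<in>carrier L.
        lie_br L (B u) (B v) =
        B (\<psi> (lie_br L (B u) (\<phi> v) \<oplus>\<^bsub>L\<^esub> lie_br L (\<phi> u) (B v) \<oplus>\<^bsub>L\<^esub> lie_br L (\<phi> u) (\<phi> v))))"


section \<open>Lie groups and their Lie algebras\<close>

definition lie_group ::
    "('a, 'm) monoid_scheme \<Rightarrow> ('a, 'e::real_normed_vector) mfd \<Rightarrow> bool" where
  "lie_group G M \<longleftrightarrow> group G \<and> smooth_manifold M \<and> topspace (mtop M) = carrier G \<and>
     smooth_map (prod_mfd M M) M (\<lambda>(x, y). x \<otimes>\<^bsub>G\<^esub> y) \<and> smooth_map M M (\<lambda>x. inv\<^bsub>G\<^esub> x)"

definition left_inv_field ::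
    "('a, 'm) monoid_scheme \<Rightarrow> ('a, 'e::real_normed_vector) mfd \<Rightarrow> 'a tangent
      \<Rightarrow> 'a \<Rightarrow> 'a tangent" where
  "left_inv_field G M u g = tangent_map M \<one>\<^bsub>G\<^esub> (\<lambda>x. g \<otimes>\<^bsub>G\<^esub> x) u"

definition real_ring :: "real ring" where
  "real_ring = \<lparr>carrier = UNIV, mult = (*), one = 1, zero = 0, add = (+)\<rparr>"

definition lie_algebra_of ::
    "('a, 'm) monoid_scheme \<Rightarrow> ('a, 'e::real_normed_vector) mfd \<Rightarrow> (real, 'a tangent) lie_alg" where
  "lie_algebra_of G M =
     \<lparr>carrier = tangent_space M \<one>\<^bsub>G\<^esub>, mult = undefined, one = undefined,
      zero = (\<lambda>f. 0), add = (\<lambda>u v f. u f + v f), smult = (\<lambda>r u f. r * u f),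
      lie_br = (\<lambda>u v. vf_bracket M (left_inv_field G M u) (left_inv_field G M v) \<one>\<^bsub>G\<^esub>)\<rparr>"


section \<open>Rota-Baxter operators with pair-weight on groups\<close>

definition pair_group :: "('a, 'm) monoid_scheme \<Rightarrow> ('a \<Rightarrow> 'a) \<Rightarrow> ('a \<Rightarrow> 'a) \<Rightarrow> bool" where
  "pair_group G \<Phi> \<Psi> \<longleftrightarrow> group G \<and> \<Phi> \<in> carrier G \<rightarrow> carrier G \<and> \<Psi> \<in> carrier G \<rightarrow> carrier G \<and>
     (\<forall>x\<in>carrier G. \<Phi> (\<Psi> x) = x)"

definition rota_baxter_operator ::
    "('a, 'm) monoid_scheme \<Rightarrow> ('a \<Rightarrow> 'a) \<Rightarrow> ('a \<Rightarrow> 'a) \<Rightarrow> ('a \<Rightarrow> 'a) \<Rightarrow> bool" where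
  "rota_baxter_operator G \<Phi> \<Psi> \<BB> \<longleftrightarrow> pair_group G \<Phi> \<Psi> \<and> \<BB> \<in> carrier G \<rightarrow> carrier G \<and>
     (\<forall>a\<in>carrier G. \<forall>b\<in>carrier G.
        \<BB> a \<otimes>\<^bsub>G\<^esub> \<BB> b = \<BB> (\<Psi> (\<Phi> a \<otimes>\<^bsub>G\<^esub> \<BB> a \<otimes>\<^bsub>G\<^esub> \<Phi> b \<otimes>\<^bsub>G\<^esub> inv\<^bsub>G\<^esub> (\<BB> a))))"

definition rota_baxter_lie_group ::
    "('a, 'm) monoid_scheme \<Rightarrow> ('a, 'e::real_normed_vector) mfd
      \<Rightarrow> ('a \<Rightarrow> 'a) \<Rightarrow> ('a \<Rightarrow> 'a) \<Rightarrow> ('a \<Rightarrow> 'a) \<Rightarrow> bool" where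
  "rota_baxter_lie_group G M \<Phi> \<Psi> \<BB> \<longleftrightarrow> lie_group G M \<and> rota_baxter_operator G \<Phi> \<Psi> \<BB> \<and>
     smooth_map M M \<Phi> \<and> smooth_map M M \<Psi> \<and> smooth_map M M \<BB>"

definition unital_pair :: "('a, 'm) monoid_scheme \<Rightarrow> ('a \<Rightarrow> 'a) \<Rightarrow> ('a \<Rightarrow> 'a) \<Rightarrow> bool" where
  "unital_pair G \<Phi> \<Psi> \<longleftrightarrow> \<Phi> \<one>\<^bsub>G\<^esub> = \<one>\<^bsub>G\<^esub> \<and> \<Psi> \<one>\<^bsub>G\<^esub> = \<one>\<^bsub>G\<^esub>"

end

theory Submission
  imports Defs
begin

text \<open>
  Represent tangent vectors \<open>u\<close>, \<open>v\<close> at the identity by curves \<open>a\<close>, \<open>b\<close>. The value of the Lie bracket on a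
  function \<open>f\<close> is then the mixed derivative \<open>\<partial>\<^sub>s\<partial>\<^sub>t\<close> at the origin of \<open>f (a s \<otimes> b t) - f (b t \<otimes> a s)\<close>
  (\<open>br_velocity\<close>), and tangent maps act on curves by composition (\<open>tangent_map_velocity\<close>). So
  \<open>[B u, B v] f\<close> is the mixed derivative of \<open>f (\<BB> (a s) \<otimes> \<BB> (b t)) - f (\<BB> (b t) \<otimes> \<BB> (a s))\<close>, and the Rota-Baxter
  identity of the group turns it into
  \<open>h (\<Phi> a \<otimes> \<BB> a \<otimes> \<Phi> b \<otimes> inv (\<BB> a)) - h (\<Phi> b \<otimes> \<BB> b \<otimes> \<Phi> a \<otimes> inv (\<BB> b))\<close> with \<open>h = f \<circ> \<BB> \<circ> \<Psi>\<close>.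
  A mixed derivative is additive over the several occurrences of one variable (\<open>mixed_deriv_diagonal\<close>), so
  the first product contributes the terms of \<open>\<Phi> a \<otimes> \<Phi> b\<close>, \<open>\<BB> a \<otimes> \<Phi> b\<close> and, with a minus sign from the inverse,
  \<open>\<Phi> b \<otimes> \<BB> a\<close> (\<open>mixed_deriv_conjugation\<close>). Together with the corresponding terms of the second product these are
  \<open>[\<phi> u, \<phi> v] + [B u, \<phi> v] + [\<phi> u, B v]\<close> applied to \<open>h\<close>, which is the claim. All curves involved pass
  through the identity because \<open>\<BB>\<close> fixes it: the group identity at \<open>a = b = e\<close> reads \<open>\<BB> e \<otimes> \<BB> e = \<BB> e\<close>.

  The claim includes that the left-invariant bracket makes the tangent space a Lie algebra. Velocities of curves
  form a vector space because in a chart they are the directional derivatives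
  (\<open>tangent_space_eq_range_chart_tangent\<close>). The bracket of two velocities is a velocity because, in a chart, the maps
  \<open>a s \<otimes> b t\<close> and \<open>b t \<otimes> a s\<close> agree on both axes, so that second derivatives of \<open>f\<close> cancel in the commutator
  (\<open>mixed_deriv_diff_eq_frechet\<close>, \<open>br_closed\<close>). The Jacobi identity is that of a commutator of operators, since the
  left-invariant field of a bracket is the commutator of the left-invariant fields (\<open>field_of_br\<close>).

  The analysis behind this is the closure of smooth maps under composition, proved by
  expanding derivatives in coordinates of a finite-dimensional space (\<open>Ck_on_compose\<close>), and the symmetry of mixed
  derivatives (\<open>symmetric_mixed_derivative\<close>).
\<close>

section \<open>Coordinates on finite-dimensional normed spaces\<close>

text \<open>The model spaces carry no fixed basis, so finite dimension is a predicate on the type; a type of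
  class \<open>euclidean_space\<close> would exclude the zero-dimensional space.\<close>

definition finite_dim :: "'e::real_normed_vector itself \<Rightarrow> bool" where
  "finite_dim _ \<longleftrightarrow> (\<exists>E::'e set. finite E \<and> span E = UNIV)"

text \<open>A convergent sequence in the span has Cauchy, hence convergent, coefficients, and the limit
  coefficients represent its limit.\<close>

lemma closed_span_if_bounded_coefficients:
  fixes B :: "'e::real_normed_vector set"
  assumes "finite B" and C: "\<And>f b. b \<in> B \<Longrightarrow> \<bar>f b\<bar> \<le> C * norm (\<Sum>b\<in>B. f b *\<^sub>R b)"
  shows "closed (span B)"
  unfolding closed_sequential_limits
proof (intro allI impI)
  fix x l assume "(\<forall>n. x n \<in> span B) \<and> x \<longlonglongrightarrow> l"
  then have xs: "\<And>n. x n \<in> span B" and lim: "x \<longlonglongrightarrow> l" by auto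
  have "\<exists>f. x n = (\<Sum>b\<in>B. f b *\<^sub>R b)" for n
    using xs[of n] span_finite[OF \<open>finite B\<close>] by auto
  then obtain f where f: "\<And>n. x n = (\<Sum>b\<in>B. f n b *\<^sub>R b)" by metis
  have diff: "x m - x n = (\<Sum>b\<in>B. (f m b - f n b) *\<^sub>R b)" for m n
    by (simp add: f scaleR_diff_left sum_subtractf)
  have Cau: "Cauchy x" using lim by (simp add: LIMSEQ_imp_Cauchy)
  have "convergent (\<lambda>n. f n b)" if b: "b \<in> B" for b
  proof -
    have bd: "\<bar>f m b - f n b\<bar> \<le> C * norm (x m - x n)" for m n
      using C[OF b, of "\<lambda>b. f m b - f n b"] diff by simp
    have "Cauchy (\<lambda>n. f n b)"
    proof (rule CauchyI)
      fix e :: real assume "e > 0"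
      then have "e / (\<bar>C\<bar> + 1) > 0" by (simp add: add_nonneg_pos)
      then obtain M where M: "\<And>m n. m \<ge> M \<Longrightarrow> n \<ge> M \<Longrightarrow> norm (x m - x n) < e / (\<bar>C\<bar> + 1)"
        using CauchyD[OF Cau] by blast
      have "norm (f m b - f n b) < e" if "m \<ge> M" "n \<ge> M" for m n
      proof -
        have "C * norm (x m - x n) \<le> (\<bar>C\<bar> + 1) * norm (x m - x n)"
          by (intro mult_right_mono) auto
        also have "\<dots> < (\<bar>C\<bar> + 1) * (e / (\<bar>C\<bar> + 1))"
          by (intro mult_strict_left_mono M that) auto
        also have "\<dots> = e" by (simp add: add_nonneg_eq_0_iff)
        finally show ?thesis using bd[of m n] by simp
      qed
      then show "\<exists>M. \<forall>m\<ge>M. \<forall>n\<ge>M. norm (f m b - f n b) < e" by blast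
    qed
    then show ?thesis by (simp add: Cauchy_convergent)
  qed
  then have "\<And>b. b \<in> B \<Longrightarrow> (\<lambda>n. f n b) \<longlonglongrightarrow> lim (\<lambda>n. f n b)"
    by (simp add: convergent_LIMSEQ_iff)
  then have "(\<lambda>n. \<Sum>b\<in>B. f n b *\<^sub>R b) \<longlonglongrightarrow> (\<Sum>b\<in>B. lim (\<lambda>n. f n b) *\<^sub>R b)"
    by (intro tendsto_sum tendsto_scaleR tendsto_const)
  then have "l = (\<Sum>b\<in>B. lim (\<lambda>n. f n b) *\<^sub>R b)"
    using lim f LIMSEQ_unique by (metis (no_types, lifting) ext)
  then show "l \<in> span B" using span_finite[OF \<open>finite B\<close>] by auto
qed

text \<open>Induction on the basis. By the induction hypothesis the span of \<open>B\<close> is closed, so a new basis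
  vector \<open>a\<close> has positive distance \<open>d\<close> from it. Dividing \<open>f a *\<^sub>R a + v\<close> with \<open>v \<in> span B\<close> by \<open>f a\<close>
  gives a difference of \<open>a\<close> and an element of the span, whence \<open>\<bar>f a\<bar> \<le> norm (f a *\<^sub>R a + v) / d\<close>;
  subtracting \<open>f a *\<^sub>R a\<close> then bounds the remaining coefficients.\<close>

lemma bounded_coefficients:
  fixes B :: "'e::real_normed_vector set"
  assumes "finite B" "independent B"
  shows "\<exists>C. \<forall>f. \<forall>b\<in>B. \<bar>f b\<bar> \<le> C * norm (\<Sum>b\<in>B. f b *\<^sub>R b)"
  using assms
proof (induction B)
  case empty
  then show ?case by simp
next
  case (insert a B)
  then have ind: "independent B" and a: "a \<notin> span B"
    by (simp_all add: independent_insert)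
  from insert.IH[OF ind] obtain C
    where C: "\<And>f b. b \<in> B \<Longrightarrow> \<bar>f b\<bar> \<le> C * norm (\<Sum>b\<in>B. f b *\<^sub>R b)" by blast
  have "open (- span B)"
    using closed_span_if_bounded_coefficients[OF \<open>finite B\<close> C] by (simp add: open_Compl)
  then obtain d where d: "d > 0" "ball a d \<subseteq> - span B"
    using a by (meson ComplI open_contains_ball)
  have fa: "\<bar>f a\<bar> \<le> (1 / d) * norm (\<Sum>b\<in>insert a B. f b *\<^sub>R b)" for f
  proof (cases "f a = 0")
    case True
    then show ?thesis using d by simp
  next
    case False
    define v where "v = (\<Sum>b\<in>B. f b *\<^sub>R b)"
    have "v \<in> span B" unfolding v_def by (intro span_sum span_scale span_base)
    then have "- (1 / f a) *\<^sub>R v \<in> span B" by (rule span_scale)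
    then have "d \<le> dist a (- (1 / f a) *\<^sub>R v)" using d by (metis ComplD mem_ball not_le subset_iff)
    also have "\<dots> = norm ((1 / f a) *\<^sub>R (f a *\<^sub>R a + v))"
      using False by (simp add: dist_norm scaleR_add_right)
    also have "\<dots> = norm (f a *\<^sub>R a + v) / \<bar>f a\<bar>" by simp
    finally show ?thesis using False d insert.hyps
      by (simp add: v_def field_simps)
  qed
  define K where "K = max (1 / d) (\<bar>C\<bar> * (1 + norm a / d))"
  have "\<bar>f b\<bar> \<le> K * norm (\<Sum>b\<in>insert a B. f b *\<^sub>R b)" if b: "b \<in> insert a B" for f b
  proof -
    define x where "x = (\<Sum>b\<in>insert a B. f b *\<^sub>R b)"
    have K: "(1 / d) * norm x \<le> K * norm x" "\<bar>C\<bar> * (1 + norm a / d) * norm x \<le> K * norm x"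
      unfolding K_def by (intro mult_right_mono; simp)+
    show ?thesis
    proof (cases "b = a")
      case True
      then show ?thesis using fa[of f] K(1) unfolding x_def by simp
    next
      case False
      then have "b \<in> B" using b by simp
      have "(\<Sum>b\<in>B. f b *\<^sub>R b) = x - f a *\<^sub>R a"
        using insert.hyps by (simp add: x_def)
      then have "norm (\<Sum>b\<in>B. f b *\<^sub>R b) \<le> norm x + \<bar>f a\<bar> * norm a"
        using norm_triangle_ineq4[of x "f a *\<^sub>R a"] by simp
      moreover have "\<bar>f a\<bar> * norm a \<le> (1 / d) * norm x * norm a"
        by (rule mult_right_mono) (use fa[of f] x_def in auto)
      ultimately have "norm (\<Sum>b\<in>B. f b *\<^sub>R b) \<le> norm x + (1 / d) * norm x * norm a"
        by (rule order_trans[OF _ add_left_mono])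
      then have le: "norm (\<Sum>b\<in>B. f b *\<^sub>R b) \<le> (1 + norm a / d) * norm x"
        by (simp add: algebra_simps)
      have "\<bar>f b\<bar> \<le> C * norm (\<Sum>b\<in>B. f b *\<^sub>R b)" using C[OF \<open>b \<in> B\<close>] .
      also have "\<dots> \<le> \<bar>C\<bar> * norm (\<Sum>b\<in>B. f b *\<^sub>R b)" by (intro mult_right_mono) auto
      also have "\<dots> \<le> \<bar>C\<bar> * ((1 + norm a / d) * norm x)" by (intro mult_left_mono le) auto
      finally show ?thesis using K(2) unfolding x_def by (simp add: mult.assoc)
    qed
  qed
  then show ?case by blast
qed

text \<open>Continuity of the coordinate functionals \<open>\<kappa> b\<close> is what allows a Frechet derivative to be
  written as a smooth combination of directional derivatives in the directions \<open>b\<close>.\<close>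

lemma finite_dim_coordinates:
  assumes "finite_dim TYPE('e::real_normed_vector)"
  obtains B :: "'e::real_normed_vector set" and \<kappa> :: "'e::real_normed_vector \<Rightarrow> 'e \<Rightarrow> real"
  where "finite B" "\<And>b. b \<in> B \<Longrightarrow> bounded_linear (\<kappa> b)" "\<And>x. x = (\<Sum>b\<in>B. \<kappa> b x *\<^sub>R b)"
proof -
  obtain E :: "'e set" where E: "finite E" "span E = UNIV"
    using assms by (auto simp: finite_dim_def)
  obtain B where B: "B \<subseteq> E" "independent B" "E \<subseteq> span B"
    using maximal_independent_subset[of E] by blast
  have fin: "finite B" using B E finite_subset by blast
  have UN: "span B = UNIV" using B E by (metis span_mono span_span top.extremum_uniqueI)
  define \<kappa> where "\<kappa> = (\<lambda>b x. representation B x b)"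
  have eq: "x = (\<Sum>b\<in>B. \<kappa> b x *\<^sub>R b)" for x
    unfolding \<kappa>_def using B UN fin by (metis UNIV_I order_refl sum_representation_eq)
  obtain C where C: "\<And>f b. b \<in> B \<Longrightarrow> \<bar>f b\<bar> \<le> C * norm (\<Sum>b\<in>B. f b *\<^sub>R b)"
    using bounded_coefficients[OF fin B(2)] by blast
  have "bounded_linear (\<kappa> b)" if "b \<in> B" for b
  proof (rule bounded_linear_intro[where K = C])
    show "\<kappa> b (x + y) = \<kappa> b x + \<kappa> b y" for x y
      unfolding \<kappa>_def using representation_add[OF B(2)] UN by simp
    show "\<kappa> b (r *\<^sub>R x) = r *\<^sub>R \<kappa> b x" for r x
      unfolding \<kappa>_def using representation_scale[OF B(2)] UN by simp
    show "norm (\<kappa> b x) \<le> norm x * C" for x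
      using C[OF that, of "\<lambda>b. \<kappa> b x"] eq[of x] by (simp add: mult.commute)
  qed
  then show ?thesis using that fin eq by blast
qed

lemma finite_dim_euclidean: "finite_dim TYPE('e::euclidean_space)"
  unfolding finite_dim_def using finite_Basis span_Basis by blast

lemma finite_dim_prod:
  assumes "finite_dim TYPE('e::real_normed_vector)" "finite_dim TYPE('f::real_normed_vector)"
  shows "finite_dim TYPE('e::real_normed_vector \<times> 'f::real_normed_vector)"
proof -
  obtain E :: "'e set" and F :: "'f set"
    where E: "finite E" "span E = UNIV" and F: "finite F" "span F = UNIV"
    using assms by (auto simp: finite_dim_def)
  define S where "S = (\<lambda>x. (x, 0::'f)) ` E \<union> (\<lambda>y. (0::'e, y)) ` F"
  have "(x, y) \<in> span S" for x :: 'e and y :: 'f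
  proof -
    have l: "linear (\<lambda>x::'e. (x, 0::'f))" "linear (\<lambda>y::'f. (0::'e, y))"
      by (auto intro!: linearI)
    have "(\<lambda>x. (x, 0::'f)) ` span E = span ((\<lambda>x. (x, 0::'f)) ` E)"
      by (rule span_linear_image[OF l(1), symmetric])
    moreover have "(\<lambda>y. (0::'e, y)) ` span F = span ((\<lambda>y. (0::'e, y)) ` F)"
      by (rule span_linear_image[OF l(2), symmetric])
    ultimately have "(x, 0) \<in> span ((\<lambda>x. (x, 0::'f)) ` E)" "(0, y) \<in> span ((\<lambda>y. (0::'e, y)) ` F)"
      using E F by auto
    then have "(x, 0) \<in> span S" "(0, y) \<in> span S"
      unfolding S_def by (meson Un_upper1 Un_upper2 span_mono subsetD)+
    then have "(x, 0) + (0, y) \<in> span S" by (rule span_add)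
    then show ?thesis by simp
  qed
  then have "span S = UNIV" by auto
  moreover have "finite S" unfolding S_def using E F by simp
  ultimately show ?thesis unfolding finite_dim_def by blast
qed

section \<open>Calculus of \<open>C\<^sup>k\<close> maps\<close>

lemma frechet_derivative_eqI:
  "(f has_derivative f') (at x) \<Longrightarrow> frechet_derivative f (at x) = f'"
  by (metis frechet_derivative_at)

lemma Ck_on_cong:
  assumes "open S" "\<And>x. x \<in> S \<Longrightarrow> f x = g x" "Ck_on k S f"
  shows "Ck_on k S g"
  using assms(2,3)
proof (induction k arbitrary: f g)
  case 0
  then show ?case by (simp cong: continuous_on_cong)
next
  case (Suc k)
  have fg: "(g has_derivative f') (at x)" if "(f has_derivative f') (at x)" "x \<in> S" for f' x
    using that Suc.prems(1) assms(1) has_derivative_transform_within_open by blast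
  have df: "\<And>x. x \<in> S \<Longrightarrow> f differentiable (at x)" using Suc.prems by simp
  have "frechet_derivative f (at x) = frechet_derivative g (at x)" if "x \<in> S" for x
    using fg[OF _ that] df[OF that] frechet_derivative_works frechet_derivative_eqI by metis
  then have "Ck_on k S (\<lambda>x. frechet_derivative g (at x) v)" for v
    using Suc.IH[of "\<lambda>x. frechet_derivative f (at x) v" "\<lambda>x. frechet_derivative g (at x) v"]
      Suc.prems(2) by simp
  moreover have "\<And>x. x \<in> S \<Longrightarrow> g differentiable (at x)"
    using df fg unfolding differentiable_def by blast
  ultimately show ?case by simp
qed

lemma Ck_on_subset: "Ck_on k S f \<Longrightarrow> T \<subseteq> S \<Longrightarrow> Ck_on k T f"
  by (induction k arbitrary: f) (auto intro: continuous_on_subset)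

lemma Ck_on_locally:
  assumes "\<And>x. x \<in> S \<Longrightarrow> \<exists>T. open T \<and> x \<in> T \<and> Ck_on k T f"
  shows "Ck_on k S f"
  using assms
proof (induction k arbitrary: f)
  case 0
  have "isCont f x" if "x \<in> S" for x
    using 0[OF that] by (auto simp: continuous_on_eq_continuous_at)
  then show ?case by (simp add: continuous_at_imp_continuous_on)
next
  case (Suc k)
  have "Ck_on k S (\<lambda>x. frechet_derivative f (at x) v)" for v
    by (rule Suc.IH) (use Suc.prems in fastforce)
  moreover have "\<And>x. x \<in> S \<Longrightarrow> f differentiable (at x)"
    using Suc.prems by fastforce
  ultimately show ?case by simp
qed

text \<open>\<open>Ck_on\<close> refers to the chosen \<open>frechet_derivative\<close>; this rule accepts any explicitly given
  derivative, and so carries the induction steps of the closure properties below.\<close>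

lemma Ck_on_SucI:
  assumes "open S" "\<And>x. x \<in> S \<Longrightarrow> (f has_derivative f' x) (at x)" "\<And>v. Ck_on k S (\<lambda>x. f' x v)"
  shows "Ck_on (Suc k) S f"
proof -
  have "Ck_on k S (\<lambda>x. frechet_derivative f (at x) v)" for v
    by (rule Ck_on_cong[OF assms(1) _ assms(3)[of v]])
      (use assms(2) frechet_derivative_eqI in metis)
  then show ?thesis using assms(2) unfolding Ck_on.simps differentiable_def by blast
qed

lemma Ck_on_Suc_D: "Ck_on (Suc k) S f \<Longrightarrow> Ck_on k S f"
proof (induction k arbitrary: f)
  case 0
  then show ?case
    by (auto intro!: continuous_at_imp_continuous_on differentiable_imp_continuous_within)
next
  case (Suc k)
  then show ?case by (metis Ck_on.simps(2))
qed

lemma Ck_on_has_derivative: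
  "Ck_on (Suc k) S f \<Longrightarrow> x \<in> S \<Longrightarrow> (f has_derivative frechet_derivative f (at x)) (at x)"
  using frechet_derivative_works by auto

lemma Ck_on_const: "open S \<Longrightarrow> Ck_on k S (\<lambda>x. c)"
proof (induction k arbitrary: c)
  case (Suc k)
  then show ?case by (intro Ck_on_SucI[where f' = "\<lambda>x v. 0"]) auto
qed auto

lemma Ck_on_bounded_linear: "bounded_linear L \<Longrightarrow> open S \<Longrightarrow> Ck_on k S L"
proof (induction k)
  case 0
  then show ?case by (simp add: linear_continuous_on)
next
  case (Suc k)
  then show ?case
    by (intro Ck_on_SucI[where f' = "\<lambda>x. L"] bounded_linear_imp_has_derivative Ck_on_const)
qed

lemma Ck_on_bounded_linear_comp:
  assumes "bounded_linear L" "open S"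
  shows "Ck_on k S f \<Longrightarrow> Ck_on k S (\<lambda>x. L (f x))"
proof (induction k arbitrary: f)
  case 0
  then show ?case using assms by (simp add: bounded_linear.continuous_on)
next
  case (Suc k)
  then show ?case
    by (intro Ck_on_SucI[where f' = "\<lambda>x v. L (frechet_derivative f (at x) v)"]
        bounded_linear.has_derivative[OF assms(1)] Ck_on_has_derivative) (use assms in auto)
qed

lemma Ck_on_Pair:
  assumes "open S"
  shows "Ck_on k S f \<Longrightarrow> Ck_on k S g \<Longrightarrow> Ck_on k S (\<lambda>x. (f x, g x))"
proof (induction k arbitrary: f g)
  case 0
  then show ?case by (simp add: continuous_on_Pair)
next
  case (Suc k)
  then show ?case
    by (intro Ck_on_SucI[where f' = "\<lambda>x v. (frechet_derivative f (at x) v, frechet_derivative g (at x) v)"]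
        has_derivative_Pair Ck_on_has_derivative) (use assms in auto)
qed

lemma Ck_on_add:
  assumes "open S" "Ck_on k S f" "Ck_on k S g"
  shows "Ck_on k S (\<lambda>x. f x + g x)"
  using Ck_on_bounded_linear_comp[OF bounded_linear_add[OF bounded_linear_fst bounded_linear_snd]
      assms(1) Ck_on_Pair[OF assms]] by simp

lemma Ck_on_sum:
  assumes "open S" "\<And>i. i \<in> I \<Longrightarrow> Ck_on k S (f i)"
  shows "Ck_on k S (\<lambda>x. \<Sum>i\<in>I. f i x)"
  using assms(2)
proof (induction I rule: infinite_finite_induct)
  case (insert i I)
  then show ?case by (simp add: Ck_on_add assms(1))
qed (simp_all add: Ck_on_const assms(1))

lemma Ck_on_scaleR:
  fixes f :: "'e::real_normed_vector \<Rightarrow> real"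
  assumes "open S"
  shows "Ck_on k S f \<Longrightarrow> Ck_on k S g \<Longrightarrow> Ck_on k S (\<lambda>x. f x *\<^sub>R g x)"
proof (induction k arbitrary: f g)
  case 0
  then show ?case by (simp add: continuous_on_scaleR)
next
  case (Suc k)
  show ?case
  proof (rule Ck_on_SucI[OF assms])
    show "((\<lambda>x. f x *\<^sub>R g x) has_derivative (\<lambda>v. f x *\<^sub>R frechet_derivative g (at x) v
        + frechet_derivative f (at x) v *\<^sub>R g x)) (at x)" if "x \<in> S" for x
      using Suc.prems that by (intro has_derivative_scaleR Ck_on_has_derivative)
    show "Ck_on k S (\<lambda>x. f x *\<^sub>R frechet_derivative g (at x) v
        + frechet_derivative f (at x) v *\<^sub>R g x)" for v
      by (rule Ck_on_add[OF assms]; rule Suc.IH)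
        (use Suc.prems Ck_on_Suc_D in auto)
  qed
qed

text \<open>The chain rule gives the derivative of \<open>g \<circ> f\<close> in direction \<open>v\<close> as \<open>g' (f x) (f' x v)\<close>, in which
  the direction at \<open>f x\<close> varies with \<open>x\<close>. Expanding \<open>f' x v\<close> in coordinates of the middle space turns this
  into a finite sum of products of coordinates of \<open>f' x v\<close> and derivatives of \<open>g\<close> in constant
  directions, to which the induction hypothesis applies.\<close>

lemma Ck_on_compose:
  fixes f :: "'d::real_normed_vector \<Rightarrow> 'e::real_normed_vector"
  assumes "finite_dim TYPE('e)" "open S" "open T"
  shows "Ck_on k S f \<Longrightarrow> Ck_on k T g \<Longrightarrow> f ` S \<subseteq> T \<Longrightarrow> Ck_on k S (\<lambda>x. g (f x))"
proof (induction k arbitrary: g)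
  case 0
  then show ?case by (auto intro: continuous_on_compose2)
next
  case (Suc k)
  obtain B :: "'e set" and \<kappa> where B: "finite B" "\<And>b. b \<in> B \<Longrightarrow> bounded_linear (\<kappa> b)"
    "\<And>x. x = (\<Sum>b\<in>B. \<kappa> b x *\<^sub>R b)"
    using finite_dim_coordinates[OF assms(1)] by blast
  define g' where "g' = (\<lambda>y. frechet_derivative g (at y))"
  define f' where "f' = (\<lambda>x. frechet_derivative f (at x))"
  have lin: "g' y w = (\<Sum>b\<in>B. \<kappa> b w *\<^sub>R g' y b)" if "y \<in> T" for y w
  proof -
    have "linear (g' y)" unfolding g'_def
      using Suc.prems that by (intro linear_frechet_derivative) auto
    then show ?thesis by (subst B(3)[of w]) (simp add: linear_sum linear_cmul)
  qed
  show ?case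
  proof (rule Ck_on_SucI[OF assms(2)])
    show "((\<lambda>x. g (f x)) has_derivative (\<lambda>v. \<Sum>b\<in>B. \<kappa> b (f' x v) *\<^sub>R g' (f x) b)) (at x)"
      if "x \<in> S" for x
    proof -
      have "(g has_derivative g' (f x)) (at (f x))" "(f has_derivative f' x) (at x)"
        unfolding f'_def g'_def using Suc.prems that by (blast intro: Ck_on_has_derivative)+
      then have "((\<lambda>x. g (f x)) has_derivative (\<lambda>v. g' (f x) (f' x v))) (at x)"
        using has_derivative_compose by blast
      moreover have "f x \<in> T" using that Suc.prems by auto
      ultimately show ?thesis by (simp add: lin[symmetric])
    qed
    show "Ck_on k S (\<lambda>x. \<Sum>b\<in>B. \<kappa> b (f' x v) *\<^sub>R g' (f x) b)" for v
    proof (intro Ck_on_sum Ck_on_scaleR Ck_on_bounded_linear_comp[OF B(2)] assms(2))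
      show "Ck_on k S (\<lambda>x. f' x v)" using Suc.prems by (simp add: f'_def)
      show "Ck_on k S (\<lambda>x. g' (f x) b)" for b
        unfolding g'_def
      proof (rule Suc.IH[OF Ck_on_Suc_D[OF Suc.prems(1)] _ Suc.prems(3)])
        show "Ck_on k T (\<lambda>y. frechet_derivative g (at y) b)"
          using Suc.prems(2) by simp
      qed
    qed
  qed
qed

section \<open>Smooth maps between manifolds\<close>

text \<open>The charts cover the space and are homeomorphisms onto open sets: this is what composition of
  smooth maps relies on, and what has to be established for \<open>prod_mfd\<close> and \<open>vec_mfd\<close>, which serve as
  intermediate manifolds.\<close>

definition charted :: "('a, 'e::real_normed_vector) mfd \<Rightarrow> bool" where
  "charted M \<longleftrightarrow> finite_dim TYPE('e) \<and> \<Union> (fst ` atlas M) = topspace (mtop M) \<and>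
     (\<forall>(U, c) \<in> atlas M. openin (mtop M) U \<and> open (c ` U) \<and>
        homeomorphic_map (subtopology (mtop M) U) (top_of_set (c ` U)) c)"

lemma charted_if_smooth_manifold: "smooth_manifold M \<Longrightarrow> charted M"
  unfolding smooth_manifold_def charted_def finite_dim_def by blast

lemma charted_finite_dim: "charted (M :: ('a, 'e::real_normed_vector) mfd) \<Longrightarrow> finite_dim TYPE('e)"
  unfolding charted_def by blast

lemma chart_at:
  assumes "charted M" "p \<in> topspace (mtop M)"
  obtains U c where "(U, c) \<in> atlas M" "p \<in> U"
  using assms unfolding charted_def by fastforce

lemma
  assumes "charted M" "(U, c) \<in> atlas M"
  shows chart_openin: "openin (mtop M) U"
    and chart_open_image: "open (c ` U)"
    and chart_homeomorphic: "homeomorphic_map (subtopology (mtop M) U) (top_of_set (c ` U)) c"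
  using assms unfolding charted_def by auto

lemma chart_inj_on:
  assumes "charted M" "(U, c) \<in> atlas M"
  shows "inj_on c U"
  using homeomorphic_imp_injective_map[OF chart_homeomorphic[OF assms]]
    openin_subset[OF chart_openin[OF assms]] by (simp add: Int_absorb1)

lemma chart_open_image_of_open:
  assumes "charted M" "(U, c) \<in> atlas M" "openin (mtop M) W" "W \<subseteq> U"
  shows "open (c ` W)"
proof -
  have "openin (top_of_set (c ` U)) (c ` W)"
    using homeomorphic_imp_open_map[OF chart_homeomorphic[OF assms(1,2)]] assms(3,4)
    unfolding open_map_def by (simp add: openin_subtopology_alt) (metis inf.absorb2 image_eqI mem_Collect_eq)
  then show ?thesis using chart_open_image[OF assms(1,2)] openin_open_trans by blast
qed

lemma continuous_map_chart:
  assumes "charted M" "(U, c) \<in> atlas M"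
  shows "continuous_map (subtopology (mtop M) U) euclidean c"
  using homeomorphic_imp_continuous_map[OF chart_homeomorphic[OF assms]]
    continuous_map_into_fulltopology by blast

lemma continuous_map_inv_chart:
  assumes "charted M" "(U, c) \<in> atlas M"
  shows "continuous_map (top_of_set (c ` U)) (mtop M) (inv_into U c)"
proof -
  obtain g where g: "homeomorphic_maps (subtopology (mtop M) U) (top_of_set (c ` U)) c g"
    using chart_homeomorphic[OF assms] homeomorphic_map_maps by blast
  then have cg: "continuous_map (top_of_set (c ` U)) (mtop M) g"
    unfolding homeomorphic_maps_def using continuous_map_into_fulltopology by blast
  have U: "U \<subseteq> topspace (mtop M)" using chart_openin[OF assms] by (rule openin_subset)
  have "g y = inv_into U c y" if y: "y \<in> c ` U" for y
  proof -
    obtain x where "x \<in> U" "y = c x" using y by blast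
    then show ?thesis using g U chart_inj_on[OF assms]
      unfolding homeomorphic_maps_def by auto
  qed
  then show ?thesis using continuous_map_eq[OF cg] by simp
qed

lemma charted_vec:
  assumes "finite_dim TYPE('e::real_normed_vector)"
  shows "charted (vec_mfd :: ('e, 'e) mfd)"
  using assms unfolding charted_def vec_mfd_def by simp

lemma charted_prod:
  fixes M :: "('a, 'e::real_normed_vector) mfd" and N :: "('b, 'f::real_normed_vector) mfd"
  assumes M: "charted M" and N: "charted N"
  shows "charted (prod_mfd M N)"
proof -
  have "\<Union> (fst ` atlas (prod_mfd M N)) = \<Union> (fst ` atlas M) \<times> \<Union> (fst ` atlas N)"
    unfolding prod_mfd_def by force
  then have 1: "\<Union> (fst ` atlas (prod_mfd M N)) = topspace (mtop (prod_mfd M N))"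
    using M N by (simp add: charted_def prod_mfd_def)
  have 2: "openin (mtop (prod_mfd M N)) (U \<times> V) \<and> open (map_prod c d ` (U \<times> V)) \<and>
      homeomorphic_map (subtopology (mtop (prod_mfd M N)) (U \<times> V))
        (top_of_set (map_prod c d ` (U \<times> V))) (map_prod c d)"
    if c: "(U, c) \<in> atlas M" and d: "(V, d) \<in> atlas N" for U c V d
  proof (intro conjI)
    show "openin (mtop (prod_mfd M N)) (U \<times> V)"
      using chart_openin[OF M c] chart_openin[OF N d]
      by (simp add: prod_mfd_def openin_prod_Times_iff)
    have im: "map_prod c d ` (U \<times> V) = c ` U \<times> d ` V" by auto
    then show "open (map_prod c d ` (U \<times> V))"
      using chart_open_image[OF M c] chart_open_image[OF N d] by (simp add: open_Times)
    obtain c' d' where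
      "homeomorphic_maps (subtopology (mtop M) U) (top_of_set (c ` U)) c c'"
      "homeomorphic_maps (subtopology (mtop N) V) (top_of_set (d ` V)) d d'"
      using chart_homeomorphic[OF M c] chart_homeomorphic[OF N d] homeomorphic_map_maps by metis
    then have "homeomorphic_maps (prod_topology (subtopology (mtop M) U) (subtopology (mtop N) V))
       (prod_topology (top_of_set (c ` U)) (top_of_set (d ` V)))
       (\<lambda>(x, y). (c x, d y)) (\<lambda>(x, y). (c' x, d' y))"
      by (intro homeomorphic_maps_prod[THEN iffD2] disjI2 conjI)
    then have "homeomorphic_map (prod_topology (subtopology (mtop M) U) (subtopology (mtop N) V))
       (prod_topology (top_of_set (c ` U)) (top_of_set (d ` V))) (\<lambda>(x, y). (c x, d y))"
      by (rule homeomorphic_maps_imp_map)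
    moreover have "map_prod c d = (\<lambda>(x, y). (c x, d y))" by (auto simp: fun_eq_iff)
    ultimately have "homeomorphic_map (subtopology (mtop (prod_mfd M N)) (U \<times> V))
        (top_of_set (c ` U \<times> d ` V)) (map_prod c d)"
      by (simp add: prod_mfd_def subtopology_Times flip: euclidean_product_topology)
    then show "homeomorphic_map (subtopology (mtop (prod_mfd M N)) (U \<times> V))
        (top_of_set (map_prod c d ` (U \<times> V))) (map_prod c d)"
      unfolding im .
  qed
  show ?thesis
    unfolding charted_def
    using 1 2 finite_dim_prod[OF charted_finite_dim[OF M] charted_finite_dim[OF N]]
    by (auto simp: prod_mfd_def)
qed

lemma smooth_map_on_openin: "smooth_map_on W M N F \<Longrightarrow> openin (mtop M) W"
  unfolding smooth_map_on_def by blast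

lemma smooth_map_on_into:
  assumes "smooth_map_on W M N F" "x \<in> W"
  shows "F x \<in> topspace (mtop N)"
proof -
  have "W \<subseteq> topspace (mtop M)" using openin_subset[OF smooth_map_on_openin[OF assms(1)]] .
  then have "x \<in> topspace (subtopology (mtop M) W)" using assms by auto
  then show ?thesis using assms unfolding smooth_map_on_def continuous_map_def by blast
qed

lemma openin_smooth_preimage:
  assumes "smooth_map_on W M N F" "openin (mtop N) V"
  shows "openin (mtop M) (W \<inter> F -` V)"
proof -
  have "openin (subtopology (mtop M) W) {x \<in> topspace (subtopology (mtop M) W). F x \<in> V}"
    using assms unfolding smooth_map_on_def by (intro openin_continuous_map_preimage) auto
  moreover have "{x \<in> topspace (subtopology (mtop M) W). F x \<in> V} = W \<inter> F -` V"
    using openin_subset[OF smooth_map_on_openin[OF assms(1)]] by auto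
  ultimately show ?thesis
    using openin_trans_full[OF _ smooth_map_on_openin[OF assms(1)]] by simp
qed

lemma smooth_map_on_subset:
  assumes "smooth_map_on W M N F" "openin (mtop M) W'" "W' \<subseteq> W"
  shows "smooth_map_on W' M N F"
proof -
  have "smooth_on (c ` (W' \<inter> U \<inter> F -` V)) (d \<circ> F \<circ> inv_into U c)"
    if "(U, c) \<in> atlas M" "(V, d) \<in> atlas N" for U c V d
  proof -
    have "smooth_on (c ` (W \<inter> U \<inter> F -` V)) (d \<circ> F \<circ> inv_into U c)"
      using assms(1) that unfolding smooth_map_on_def by blast
    then show ?thesis
      unfolding smooth_on_def using assms(3) by (blast intro: Ck_on_subset)
  qed
  then show ?thesis
    using assms unfolding smooth_map_on_def
    by (auto intro: continuous_map_from_subtopology_mono)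
qed

lemma smooth_on_cong:
  assumes "open S" "\<And>x. x \<in> S \<Longrightarrow> f x = g x" "smooth_on S f"
  shows "smooth_on S g"
  using assms Ck_on_cong unfolding smooth_on_def by metis

lemma open_chart_preimage:
  assumes "charted M" "charted N" "smooth_map_on W M N F" "(U, c) \<in> atlas M" "openin (mtop N) V"
  shows "open (c ` (W \<inter> U \<inter> F -` V))"
proof (rule chart_open_image_of_open[OF assms(1,4)])
  have "openin (mtop M) (U \<inter> (W \<inter> F -` V))"
    by (rule openin_Int[OF chart_openin[OF assms(1,4)] openin_smooth_preimage[OF assms(3,5)]])
  then show "openin (mtop M) (W \<inter> U \<inter> F -` V)" by (simp add: Int_ac)
qed auto

lemma smooth_map_on_cong:
  assumes "charted M" "charted N" "smooth_map_on W M N F" "\<And>x. x \<in> W \<Longrightarrow> F x = F' x"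
  shows "smooth_map_on W M N F'"
  unfolding smooth_map_on_def
proof (intro conjI ballI, safe)
  show "openin (mtop M) W" using assms(3) by (rule smooth_map_on_openin)
  show "continuous_map (subtopology (mtop M) W) (mtop N) F'"
    using assms(3,4) unfolding smooth_map_on_def
    by (auto intro: continuous_map_eq)
  fix U c V d assume c: "(U, c) \<in> atlas M" and d: "(V, d) \<in> atlas N"
  have eq: "W \<inter> U \<inter> F' -` V = W \<inter> U \<inter> F -` V" using assms(4) by auto
  show "smooth_on (c ` (W \<inter> U \<inter> F' -` V)) (d \<circ> F' \<circ> inv_into U c)"
    unfolding eq
  proof (rule smooth_on_cong)
    show "open (c ` (W \<inter> U \<inter> F -` V))"
      by (rule open_chart_preimage[OF assms(1-3) c chart_openin[OF assms(2) d]])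
    show "smooth_on (c ` (W \<inter> U \<inter> F -` V)) (d \<circ> F \<circ> inv_into U c)"
      using assms(3) c d unfolding smooth_map_on_def by blast
    show "(d \<circ> F \<circ> inv_into U c) x = (d \<circ> F' \<circ> inv_into U c) x"
      if "x \<in> c ` (W \<inter> U \<inter> F -` V)" for x
      using that assms(4) chart_inj_on[OF assms(1) c] by auto
  qed
qed

text \<open>Smoothness of a chart expression may be tested near each point \<open>c q\<close>. There the expression
  factors through a chart \<open>d1\<close> of the middle manifold at \<open>F q\<close>, and the composition rule for \<open>C\<^sup>k\<close> maps
  applies to the two factors.\<close>

lemma smooth_map_on_compose:
  assumes M: "charted M" and N: "charted N" and P: "charted P"
    and F: "smooth_map_on W M N F" and H: "smooth_map_on W' N P H"
  shows "smooth_map_on (W \<inter> F -` W') M P (\<lambda>x. H (F x))"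
  unfolding smooth_map_on_def
proof (intro conjI ballI, safe)
  let ?W = "W \<inter> F -` W'"
  show oW: "openin (mtop M) ?W"
    by (rule openin_smooth_preimage[OF F smooth_map_on_openin[OF H]])
  have "continuous_map (subtopology (mtop M) ?W) (mtop N) F"
    using F unfolding smooth_map_on_def
    by (auto intro: continuous_map_from_subtopology_mono)
  then have cF: "continuous_map (subtopology (mtop M) ?W) (subtopology (mtop N) W') F"
    by (auto simp: continuous_map_in_subtopology)
  moreover have cH: "continuous_map (subtopology (mtop N) W') (mtop P) H"
    using H unfolding smooth_map_on_def by blast
  ultimately have cHF: "continuous_map (subtopology (mtop M) ?W) (mtop P) (H \<circ> F)"
    by (rule continuous_map_compose)
  then show "continuous_map (subtopology (mtop M) ?W) (mtop P) (\<lambda>x. H (F x))"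
    by (simp add: comp_def)
  fix U c V d assume c: "(U, c) \<in> atlas M" and d: "(V, d) \<in> atlas P"
  show "smooth_on (c ` (?W \<inter> U \<inter> (\<lambda>x. H (F x)) -` V)) (d \<circ> (\<lambda>x. H (F x)) \<circ> inv_into U c)"
    unfolding smooth_on_def
  proof (intro allI Ck_on_locally)
    fix k x assume "x \<in> c ` (?W \<inter> U \<inter> (\<lambda>x. H (F x)) -` V)"
    then obtain q where q: "x = c q" "q \<in> W" "F q \<in> W'" "q \<in> U" "H (F q) \<in> V" by auto
    obtain V1 d1 where d1: "(V1, d1) \<in> atlas N" "F q \<in> V1"
      using chart_at[OF N smooth_map_on_into[OF F \<open>q \<in> W\<close>]] .
    define S2 where "S2 = W' \<inter> V1 \<inter> H -` V"
    define S1 where "S1 = W \<inter> U \<inter> F -` S2"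
    have "openin (mtop N) (W' \<inter> H -` V)"
      by (rule openin_smooth_preimage[OF H chart_openin[OF P d]])
    then have "openin (mtop N) (V1 \<inter> (W' \<inter> H -` V))"
      by (rule openin_Int[OF chart_openin[OF N d1(1)]])
    then have oS2: "openin (mtop N) S2" by (simp add: S2_def Int_ac)
    have o2: "open (d1 ` S2)"
      by (rule chart_open_image_of_open[OF N d1(1) oS2]) (auto simp: S2_def)
    have o1: "open (c ` S1)"
      unfolding S1_def by (rule open_chart_preimage[OF M N F c oS2])
    have f: "Ck_on k (c ` S1) (d1 \<circ> F \<circ> inv_into U c)"
    proof (rule Ck_on_subset)
      show "Ck_on k (c ` (W \<inter> U \<inter> F -` V1)) (d1 \<circ> F \<circ> inv_into U c)"
        using F c d1(1) unfolding smooth_map_on_def smooth_on_def by blast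
    qed (auto simp: S1_def S2_def)
    have h: "Ck_on k (d1 ` S2) (d \<circ> H \<circ> inv_into V1 d1)"
      using H d d1(1) unfolding smooth_map_on_def smooth_on_def S2_def by blast
    note ic = chart_inj_on[OF M c] and id1 = chart_inj_on[OF N d1(1)]
    have "Ck_on k (c ` S1) (\<lambda>x. (d \<circ> H \<circ> inv_into V1 d1) ((d1 \<circ> F \<circ> inv_into U c) x))"
      by (rule Ck_on_compose[OF charted_finite_dim[OF N] o1 o2 f h])
        (use ic in \<open>auto simp: S1_def\<close>)
    then have "Ck_on k (c ` S1) (d \<circ> (\<lambda>x. H (F x)) \<circ> inv_into U c)"
      by (rule Ck_on_cong[OF o1, rotated]) (use ic id1 in \<open>auto simp: S1_def S2_def\<close>)
    then show "\<exists>T. open T \<and> x \<in> T \<and> Ck_on k T (d \<circ> (\<lambda>x. H (F x)) \<circ> inv_into U c)"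
      using o1 q d1(2) by (intro exI[of _ "c ` S1"]) (auto simp: S1_def S2_def)
  qed
qed

lemma smooth_map_on_Pair:
  assumes M: "charted M" and N: "charted N" and P: "charted P"
    and F: "smooth_map_on W M N F" and H: "smooth_map_on W M P H"
  shows "smooth_map_on W M (prod_mfd N P) (\<lambda>x. (F x, H x))"
  unfolding smooth_map_on_def
proof (intro conjI ballI, safe)
  show "openin (mtop M) W" using F by (rule smooth_map_on_openin)
  show "continuous_map (subtopology (mtop M) W) (mtop (prod_mfd N P)) (\<lambda>x. (F x, H x))"
    using F H unfolding smooth_map_on_def prod_mfd_def by (simp add: continuous_map_pairedI)
  fix U c V d assume c: "(U, c) \<in> atlas M" and "(V, d) \<in> atlas (prod_mfd N P)"
  then obtain V1 d1 V2 d2 where d: "V = V1 \<times> V2" "d = map_prod d1 d2"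
    "(V1, d1) \<in> atlas N" "(V2, d2) \<in> atlas P"
    unfolding prod_mfd_def by auto
  let ?S = "W \<inter> U \<inter> (\<lambda>x. (F x, H x)) -` (V1 \<times> V2)"
  have S: "?S = (W \<inter> U \<inter> F -` V1) \<inter> (W \<inter> U \<inter> H -` V2)" by auto
  have "openin (mtop M) (U \<inter> ((W \<inter> F -` V1) \<inter> (W \<inter> H -` V2)))"
    using openin_smooth_preimage[OF F chart_openin[OF N d(3)]]
      openin_smooth_preimage[OF H chart_openin[OF P d(4)]] chart_openin[OF M c]
    by blast
  moreover have "U \<inter> ((W \<inter> F -` V1) \<inter> (W \<inter> H -` V2)) = ?S" by auto
  ultimately have o: "open (c ` ?S)"
    by (intro chart_open_image_of_open[OF M c]) auto
  have "Ck_on k (c ` ?S) (map_prod d1 d2 \<circ> (\<lambda>x. (F x, H x)) \<circ> inv_into U c)" for k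
  proof -
    have 1: "Ck_on k (c ` (W \<inter> U \<inter> F -` V1)) (d1 \<circ> F \<circ> inv_into U c)"
      "Ck_on k (c ` (W \<inter> U \<inter> H -` V2)) (d2 \<circ> H \<circ> inv_into U c)"
      using F H c d unfolding smooth_map_on_def smooth_on_def by blast+
    have "Ck_on k (c ` ?S) (d1 \<circ> F \<circ> inv_into U c)" "Ck_on k (c ` ?S) (d2 \<circ> H \<circ> inv_into U c)"
      by (rule Ck_on_subset[OF 1(1)], use S in auto) (rule Ck_on_subset[OF 1(2)], use S in auto)
    from Ck_on_Pair[OF o this] show ?thesis by (simp add: comp_def)
  qed
  then show "smooth_on (c ` (W \<inter> U \<inter> (\<lambda>x. (F x, H x)) -` V)) (d \<circ> (\<lambda>x. (F x, H x)) \<circ> inv_into U c)"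
    unfolding d smooth_on_def by simp
qed

lemma smooth_map_on_vec_iff:
  "smooth_map_on S vec_mfd vec_mfd f \<longleftrightarrow> open S \<and> smooth_on S f"
proof -
  have "inv_into UNIV (id :: 'x \<Rightarrow> 'x) = id" by (simp add: inv_id)
  moreover have "smooth_on S f \<Longrightarrow> continuous_on S f"
    unfolding smooth_on_def by (metis Ck_on.simps(1))
  ultimately show ?thesis
    unfolding smooth_map_on_def vec_mfd_def by auto
qed

text \<open>The product of two normed spaces carries both the structure \<open>vec_mfd\<close> and the structure
  \<open>prod_mfd vec_mfd vec_mfd\<close>; this rule builds pairs for the first one.\<close>

lemma smooth_map_on_Pair_vec:
  assumes "smooth_map_on W M vec_mfd F" "smooth_map_on W M vec_mfd H" "charted M"
  shows "smooth_map_on W M vec_mfd (\<lambda>x. (F x, H x))"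
proof -
  have "smooth_on (c ` (W \<inter> U)) (\<lambda>x. (F (inv_into U c x), H (inv_into U c x)))"
    if c: "(U, c) \<in> atlas M" for U c
  proof -
    have "openin (mtop M) (W \<inter> U)"
      using smooth_map_on_openin[OF assms(1)] chart_openin[OF assms(3) c] by (rule openin_Int)
    then have "open (c ` (W \<inter> U))"
      by (rule chart_open_image_of_open[OF assms(3) c]) auto
    moreover have "smooth_on (c ` (W \<inter> U)) (\<lambda>x. F (inv_into U c x))"
      "smooth_on (c ` (W \<inter> U)) (\<lambda>x. H (inv_into U c x))"
      using assms(1,2) c unfolding smooth_map_on_def vec_mfd_def by (auto simp: comp_def)
    ultimately show ?thesis
      unfolding smooth_on_def by (intro allI Ck_on_Pair) auto
  qed
  moreover have "continuous_map (subtopology (mtop M) W) (mtop vec_mfd) (\<lambda>x. (F x, H x))"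
  proof -
    have "continuous_map (subtopology (mtop M) W) euclidean F"
      "continuous_map (subtopology (mtop M) W) euclidean H"
      using assms(1,2) unfolding smooth_map_on_def vec_mfd_def by simp_all
    then show ?thesis
      using continuous_map_pairedI[of _ euclidean F euclidean H]
      by (simp add: vec_mfd_def euclidean_product_topology)
  qed
  ultimately show ?thesis
    using smooth_map_on_openin[OF assms(1)] unfolding smooth_map_on_def
    by (auto simp: vec_mfd_def comp_def)
qed

text \<open>In the charts of the manifold, a chart and its inverse are transition maps.\<close>

lemma smooth_map_on_chart:
  assumes M: "smooth_manifold M" and c: "(U, c) \<in> atlas M"
  shows "smooth_map_on U M vec_mfd c"
proof -
  have "smooth_on (c' ` (U' \<inter> U)) (c \<circ> inv_into U' c')" if "(U', c') \<in> atlas M" for U' c'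
    using M c that unfolding smooth_manifold_def by blast
  then show ?thesis
    unfolding smooth_map_on_def
    using chart_openin[OF charted_if_smooth_manifold[OF M] c]
      continuous_map_chart[OF charted_if_smooth_manifold[OF M] c]
    by (auto simp: vec_mfd_def Int_commute)
qed

lemma smooth_map_on_inv_chart:
  assumes M: "smooth_manifold M" and c: "(U, c) \<in> atlas M"
  shows "smooth_map_on (c ` U) vec_mfd M (inv_into U c)"
proof -
  note i = chart_inj_on[OF charted_if_smooth_manifold[OF M] c]
  have "smooth_on (c ` U \<inter> inv_into U c -` V) (d \<circ> inv_into U c)" if "(V, d) \<in> atlas M" for V d
  proof -
    have "smooth_on (c ` (U \<inter> V)) (d \<circ> inv_into U c)"
      using M c that unfolding smooth_manifold_def by blast
    moreover have "c ` U \<inter> inv_into U c -` V = c ` (U \<inter> V)" using i by auto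
    ultimately show ?thesis by simp
  qed
  then show ?thesis
    unfolding smooth_map_on_def
    using chart_open_image[OF charted_if_smooth_manifold[OF M] c]
      continuous_map_inv_chart[OF charted_if_smooth_manifold[OF M] c]
    by (auto simp: vec_mfd_def inv_id)
qed

section \<open>Smoothness at a point\<close>

text \<open>Smoothness on some neighbourhood of a point. It composes without mention of domains, as
  continuity at a point does, and it covers both \<open>smooth_fun_near\<close> and \<open>smooth_curve_at\<close>.\<close>

definition smooth_at ::
    "('a, 'e::real_normed_vector) mfd \<Rightarrow> ('b, 'f::real_normed_vector) mfd \<Rightarrow> 'a \<Rightarrow> ('a \<Rightarrow> 'b) \<Rightarrow> bool"
  where "smooth_at M N p F \<longleftrightarrow> (\<exists>W. p \<in> W \<and> smooth_map_on W M N F)"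

lemma smooth_fun_near_iff: "smooth_fun_near M p f \<longleftrightarrow> smooth_at M vec_mfd p f"
  unfolding smooth_fun_near_def smooth_at_def ..

lemma smooth_curve_at_iff: "smooth_curve_at M p \<gamma> \<longleftrightarrow> \<gamma> 0 = p \<and> smooth_at vec_mfd M 0 \<gamma>"
  unfolding smooth_curve_at_def smooth_at_def ..

lemma smooth_at_topspace:
  assumes "smooth_at M N p F"
  shows "p \<in> topspace (mtop M)" "F p \<in> topspace (mtop N)"
proof -
  obtain W where W: "p \<in> W" "smooth_map_on W M N F" using assms unfolding smooth_at_def by blast
  show "F p \<in> topspace (mtop N)" by (rule smooth_map_on_into[OF W(2,1)])
  show "p \<in> topspace (mtop M)"
    using openin_subset[OF smooth_map_on_openin[OF W(2)]] W(1) by blast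
qed

lemma smooth_at_if_smooth_map: "smooth_map M N F \<Longrightarrow> p \<in> topspace (mtop M) \<Longrightarrow> smooth_at M N p F"
  unfolding smooth_at_def by blast

lemma smooth_at_neighbourhood:
  assumes "smooth_at M N p F"
  obtains W where "openin (mtop M) W" "p \<in> W" "\<And>q. q \<in> W \<Longrightarrow> smooth_at M N q F"
    "\<And>q. q \<in> W \<Longrightarrow> F q \<in> topspace (mtop N)"
  using assms smooth_map_on_into smooth_map_on_openin unfolding smooth_at_def by metis

lemma smooth_at_preimage:
  assumes "smooth_at M N p F" "openin (mtop N) V" "F p \<in> V"
  obtains W where "openin (mtop M) W" "p \<in> W" "\<And>q. q \<in> W \<Longrightarrow> F q \<in> V"
  using assms openin_smooth_preimage unfolding smooth_at_def
  by (metis IntD2 IntI vimageE vimageI)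

lemma smooth_at_compose:
  assumes "charted M" "charted N" "charted P" "smooth_at M N p F" "smooth_at N P (F p) H"
  shows "smooth_at M P p (\<lambda>x. H (F x))"
proof -
  obtain W W' where "p \<in> W" "smooth_map_on W M N F" "F p \<in> W'" "smooth_map_on W' N P H"
    using assms unfolding smooth_at_def by blast
  then show ?thesis
    using smooth_map_on_compose[OF assms(1-3)] unfolding smooth_at_def by blast
qed

lemma smooth_at_common:
  assumes "smooth_at M N p F" "smooth_at M P p H"
  obtains W where "p \<in> W" "smooth_map_on W M N F" "smooth_map_on W M P H"
proof -
  obtain W W' where W: "p \<in> W" "smooth_map_on W M N F" "p \<in> W'" "smooth_map_on W' M P H"
    using assms unfolding smooth_at_def by blast
  have "openin (mtop M) (W \<inter> W')"
    by (rule openin_Int[OF smooth_map_on_openin[OF W(2)] smooth_map_on_openin[OF W(4)]])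
  then have "smooth_map_on (W \<inter> W') M N F" "smooth_map_on (W \<inter> W') M P H"
    by (rule smooth_map_on_subset[OF W(2)], simp) (rule smooth_map_on_subset[OF W(4) \<open>openin _ _\<close>], simp)
  then show ?thesis using W that[of "W \<inter> W'"] by simp
qed

lemma smooth_at_Pair:
  assumes "charted M" "charted N" "charted P" "smooth_at M N p F" "smooth_at M P p H"
  shows "smooth_at M (prod_mfd N P) p (\<lambda>x. (F x, H x))"
proof -
  obtain W where "p \<in> W" "smooth_map_on W M N F" "smooth_map_on W M P H"
    using smooth_at_common[OF assms(4,5)] .
  then show ?thesis
    unfolding smooth_at_def using smooth_map_on_Pair[OF assms(1-3)] by (intro exI[of _ W]) simp
qed

lemma smooth_at_Pair_vec:
  assumes "charted M" "smooth_at M vec_mfd p F" "smooth_at M vec_mfd p H"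
  shows "smooth_at M vec_mfd p (\<lambda>x. (F x, H x))"
proof -
  obtain W where "p \<in> W" "smooth_map_on W M vec_mfd F" "smooth_map_on W M vec_mfd H"
    using smooth_at_common[OF assms(2,3)] .
  then show ?thesis
    unfolding smooth_at_def using smooth_map_on_Pair_vec[OF _ _ assms(1)]
    by (intro exI[of _ W]) simp
qed

lemma smooth_at_cong:
  assumes "charted M" "charted N" "smooth_at M N p F"
    "openin (mtop M) V" "p \<in> V" "\<And>x. x \<in> V \<Longrightarrow> F x = F' x"
  shows "smooth_at M N p F'"
proof -
  obtain W where W: "p \<in> W" "smooth_map_on W M N F"
    using assms unfolding smooth_at_def by blast
  have "openin (mtop M) (W \<inter> V)"
    by (rule openin_Int[OF smooth_map_on_openin[OF W(2)] assms(4)])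
  then have "smooth_map_on (W \<inter> V) M N F"
    using smooth_map_on_subset[OF W(2)] by blast
  then have "smooth_map_on (W \<inter> V) M N F'"
    by (rule smooth_map_on_cong[OF assms(1,2)]) (use assms(6) in auto)
  then show ?thesis using W assms(5) unfolding smooth_at_def by blast
qed

lemma smooth_at_vec_iff:
  "smooth_at vec_mfd vec_mfd x f \<longleftrightarrow> (\<exists>S. open S \<and> x \<in> S \<and> smooth_on S f)"
  unfolding smooth_at_def smooth_map_on_vec_iff by blast

lemma smooth_at_bounded_linear: "bounded_linear L \<Longrightarrow> smooth_at vec_mfd vec_mfd x L"
  unfolding smooth_at_vec_iff smooth_on_def using Ck_on_bounded_linear open_UNIV by blast

lemma smooth_at_affine:
  "bounded_linear L \<Longrightarrow> smooth_at vec_mfd vec_mfd x (\<lambda>y. a + L y)"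
  unfolding smooth_at_vec_iff smooth_on_def
  by (intro exI[of _ UNIV] conjI allI Ck_on_add Ck_on_const Ck_on_bounded_linear) auto

lemma smooth_at_differentiable:
  "smooth_at vec_mfd vec_mfd x f \<Longrightarrow> f differentiable (at x)"
  unfolding smooth_at_vec_iff smooth_on_def by (metis Ck_on.simps(2))

lemma smooth_at_has_derivative:
  "smooth_at vec_mfd vec_mfd x f \<Longrightarrow> (f has_derivative frechet_derivative f (at x)) (at x)"
  using smooth_at_differentiable frechet_derivative_works by blast

text \<open>Immediate from the definition of \<open>Ck_on\<close> by iterated directional derivatives, and the source
  of the smoothness of left-invariant vector fields.\<close>

lemma smooth_at_directional_derivative:
  "smooth_at vec_mfd vec_mfd x f \<Longrightarrow> smooth_at vec_mfd vec_mfd x (\<lambda>y. frechet_derivative f (at y) v)"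
  unfolding smooth_at_vec_iff smooth_on_def by (metis Ck_on.simps(2))

lemma charted_euclidean: "charted (vec_mfd :: ('v::euclidean_space, 'v) mfd)"
  by (rule charted_vec[OF finite_dim_euclidean])

lemma smooth_at_euclidean_compose:
  fixes f :: "'v::euclidean_space \<Rightarrow> 'w::euclidean_space"
  assumes "smooth_at vec_mfd vec_mfd x f" "smooth_at vec_mfd M (f x) g" "charted M"
  shows "smooth_at vec_mfd M x (\<lambda>y. g (f y))"
  by (rule smooth_at_compose[OF charted_euclidean charted_euclidean assms(3,1,2)])

lemma smooth_at_chart:
  "smooth_manifold M \<Longrightarrow> (U, c) \<in> atlas M \<Longrightarrow> p \<in> U \<Longrightarrow> smooth_at M vec_mfd p c"
  unfolding smooth_at_def using smooth_map_on_chart by blast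

lemma smooth_at_inv_chart:
  "smooth_manifold M \<Longrightarrow> (U, c) \<in> atlas M \<Longrightarrow> p \<in> U \<Longrightarrow> smooth_at vec_mfd M (c p) (inv_into U c)"
  unfolding smooth_at_def using smooth_map_on_inv_chart by blast

lemma smooth_at_id:
  assumes M: "smooth_manifold M" and "p \<in> topspace (mtop M)"
  shows "smooth_at M M p (\<lambda>x. x)"
proof -
  note ch = charted_if_smooth_manifold[OF M]
  obtain U c where c: "(U, c) \<in> atlas M" "p \<in> U" using chart_at[OF ch assms(2)] .
  have "smooth_at M M p (\<lambda>x. inv_into U c (c x))"
    by (rule smooth_at_compose[OF ch charted_vec[OF charted_finite_dim[OF ch]] ch
          smooth_at_chart[OF M c] smooth_at_inv_chart[OF M c]])
  then show ?thesis
    by (rule smooth_at_cong[OF ch ch _ chart_openin[OF ch c(1)] c(2)])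
      (use chart_inj_on[OF ch c(1)] in simp)
qed

lemma smooth_at_const:
  assumes M: "charted M" "p \<in> topspace (mtop M)" and N: "q \<in> topspace (mtop N)"
  shows "smooth_at M N p (\<lambda>x. q)"
proof -
  have "smooth_map M N (\<lambda>x. q)"
    unfolding smooth_map_on_def
  proof (intro conjI ballI, safe)
    show "continuous_map (subtopology (mtop M) (topspace (mtop M))) (mtop N) (\<lambda>x. q)"
      using N by simp
    fix U c V d assume c: "(U, c) \<in> atlas M" and d: "(V, d) \<in> atlas N"
    have "open (c ` (topspace (mtop M) \<inter> U \<inter> (\<lambda>x. q) -` V))"
    proof (cases "q \<in> V")
      case True
      then have "topspace (mtop M) \<inter> U \<inter> (\<lambda>x. q) -` V = U"
        using openin_subset[OF chart_openin[OF M(1) c]] by auto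
      then show ?thesis using chart_open_image[OF M(1) c] by simp
    qed simp
    then show "smooth_on (c ` (topspace (mtop M) \<inter> U \<inter> (\<lambda>x. q) -` V)) (d \<circ> (\<lambda>x. q) \<circ> inv_into U c)"
      unfolding smooth_on_def by (simp add: comp_def Ck_on_const)
  qed simp
  then show ?thesis using M(2) by (rule smooth_at_if_smooth_map)
qed

section \<open>Tangent spaces in charts\<close>

text \<open>The tangent vector at \<open>p\<close> whose coordinate vector in the chart \<open>c\<close> is \<open>w\<close>.\<close>

definition chart_tangent ::
    "('a, 'e::real_normed_vector) mfd \<Rightarrow> 'a \<Rightarrow> 'a set \<Rightarrow> ('a \<Rightarrow> 'e) \<Rightarrow> 'e \<Rightarrow> 'a tangent" where
  "chart_tangent M p U c w =
     (\<lambda>f. if smooth_fun_near M p f then frechet_derivative (f \<circ> inv_into U c) (at (c p)) w else 0)"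

lemma smooth_at_fun_in_chart:
  assumes M: "smooth_manifold M" and c: "(U, c) \<in> atlas M" "p \<in> U"
    and f: "smooth_at M vec_mfd p (f :: 'a \<Rightarrow> 'v::euclidean_space)"
  shows "smooth_at vec_mfd vec_mfd (c p) (f \<circ> inv_into U c)"
proof -
  note ch = charted_if_smooth_manifold[OF M]
  show ?thesis
    using smooth_at_compose[OF charted_vec[OF charted_finite_dim[OF ch]] ch
        charted_euclidean smooth_at_inv_chart[OF M c], of f] f chart_inj_on[OF ch c(1)] c(2)
    by (simp add: comp_def)
qed

lemma curve_in_chart_has_derivative:
  assumes M: "smooth_manifold M" and c: "(U, c) \<in> atlas M" "p \<in> U"
    and \<gamma>: "\<gamma> 0 = p" "smooth_at vec_mfd M (0::real) \<gamma>"
  shows "((c \<circ> \<gamma>) has_vector_derivative vector_derivative (c \<circ> \<gamma>) (at 0)) (at 0)"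
proof -
  note ch = charted_if_smooth_manifold[OF M]
  have "smooth_at vec_mfd vec_mfd 0 (\<lambda>t. c (\<gamma> t))"
    using smooth_at_compose[OF charted_euclidean ch charted_vec[OF charted_finite_dim[OF ch]] \<gamma>(2)]
      smooth_at_chart[OF M c] \<gamma>(1) by simp
  then have "(c \<circ> \<gamma>) differentiable (at 0)"
    using smooth_at_differentiable by (simp add: comp_def)
  then show ?thesis by (simp add: vector_derivative_works)
qed

text \<open>The chain rule for \<open>f \<circ> \<gamma> = (f \<circ> c\<^sup>-\<^sup>1) \<circ> (c \<circ> \<gamma>)\<close>, which holds as long as the curve stays in
  the domain of the chart.\<close>

lemma velocity_in_chart:
  assumes M: "smooth_manifold M" and c: "(U, c) \<in> atlas M" "p \<in> U"
    and \<gamma>: "\<gamma> 0 = p" "smooth_at vec_mfd M (0::real) \<gamma>"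
    and f: "smooth_at M vec_mfd p (f :: 'a \<Rightarrow> real)"
  shows "((\<lambda>t. f (\<gamma> t)) has_real_derivative
     frechet_derivative (f \<circ> inv_into U c) (at (c p)) (vector_derivative (c \<circ> \<gamma>) (at 0))) (at 0)"
proof -
  note ch = charted_if_smooth_manifold[OF M]
  define D where "D = frechet_derivative (f \<circ> inv_into U c) (at (c p))"
  define w where "w = vector_derivative (c \<circ> \<gamma>) (at 0)"
  have D: "((f \<circ> inv_into U c) has_derivative D) (at ((c \<circ> \<gamma>) 0))"
    unfolding D_def using smooth_at_has_derivative[OF smooth_at_fun_in_chart[OF M c f]] \<gamma>(1) by simp
  have "((c \<circ> \<gamma>) has_derivative (\<lambda>h. h *\<^sub>R w)) (at 0)"
    using curve_in_chart_has_derivative[OF M c \<gamma>] unfolding w_def has_vector_derivative_def .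
  from has_derivative_compose[OF this D]
  have "((\<lambda>t. (f \<circ> inv_into U c) ((c \<circ> \<gamma>) t)) has_derivative (\<lambda>h. D (h *\<^sub>R w))) (at 0)" .
  moreover have "D (h *\<^sub>R w) = D w * h" for h
    using D by (simp add: linear_cmul has_derivative_linear)
  ultimately have dw: "((\<lambda>t. (f \<circ> inv_into U c) ((c \<circ> \<gamma>) t)) has_real_derivative D w) (at 0)"
    by (simp add: has_field_derivative_def)
  obtain W where W: "openin (mtop vec_mfd) W" "0 \<in> W" "\<And>t. t \<in> W \<Longrightarrow> \<gamma> t \<in> U"
    using smooth_at_preimage[OF \<gamma>(2) chart_openin[OF ch c(1)]] \<gamma>(1) c(2) by blast
  from dw show ?thesis
    unfolding D_def w_def
  proof (rule has_field_derivative_transform_within_open)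
    show "open W" "0 \<in> W" using W by (simp_all add: vec_mfd_def)
    show "(f \<circ> inv_into U c) ((c \<circ> \<gamma>) t) = f (\<gamma> t)" if "t \<in> W" for t
      using chart_inj_on[OF ch c(1)] W(3)[OF that] by simp
  qed
qed

lemma velocity_eq_chart_tangent:
  assumes "smooth_manifold M" "(U, c) \<in> atlas M" "p \<in> U"
    and "\<gamma> 0 = p" "smooth_at vec_mfd M (0::real) \<gamma>"
  shows "velocity M p \<gamma> = chart_tangent M p U c (vector_derivative (c \<circ> \<gamma>) (at 0))"
  using DERIV_imp_deriv[OF velocity_in_chart[OF assms]]
  unfolding velocity_def chart_tangent_def fun_eq_iff by (simp add: smooth_fun_near_iff)

lemma smooth_curve_in_chart_direction:
  fixes w :: "'e::real_normed_vector"
  assumes M: "smooth_manifold M" and c: "(U, c) \<in> atlas M" "p \<in> U"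
  defines "\<gamma> \<equiv> \<lambda>t::real. inv_into U c (c p + t *\<^sub>R w)"
  shows "\<gamma> 0 = p" "smooth_at vec_mfd M 0 \<gamma>" "vector_derivative (c \<circ> \<gamma>) (at 0) = w"
proof -
  note ch = charted_if_smooth_manifold[OF M]
  note chE = charted_vec[OF charted_finite_dim[OF ch]]
  show 0: "\<gamma> 0 = p" unfolding \<gamma>_def using chart_inj_on[OF ch c(1)] c(2) by simp
  have l: "smooth_at vec_mfd vec_mfd 0 (\<lambda>t::real. c p + t *\<^sub>R w)"
    by (rule smooth_at_affine[OF bounded_linear_scaleR_left])
  show 1: "smooth_at vec_mfd M 0 \<gamma>"
    unfolding \<gamma>_def
    using smooth_at_compose[OF charted_euclidean chE ch l] smooth_at_inv_chart[OF M c] by simp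
  have "open (c ` U)" using chart_open_image[OF ch c(1)] .
  then obtain W where W: "openin (mtop vec_mfd) W" "0 \<in> W" "\<And>t. t \<in> W \<Longrightarrow> c p + t *\<^sub>R w \<in> c ` U"
    using smooth_at_preimage[OF l, of "c ` U"] c(2) by (auto simp: vec_mfd_def)
  have "((\<lambda>t. c p + t *\<^sub>R w) has_vector_derivative w) (at 0)"
    by (auto intro!: derivative_eq_intros)
  then have "((c \<circ> \<gamma>) has_vector_derivative w) (at 0)"
    by (rule has_vector_derivative_transform_within_open[where S = W])
      (use W f_inv_into_f[OF W(3)] in \<open>auto simp: vec_mfd_def \<gamma>_def\<close>)
  then show "vector_derivative (c \<circ> \<gamma>) (at 0) = w" by (rule vector_derivative_at)
qed

text \<open>In a chart, velocities of curves are exactly directional derivatives, since every direction is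
  the velocity of a straight line. Hence the tangent space is closed under the linear operations, which is not visible
  on curves.\<close>

lemma tangent_space_eq_range_chart_tangent:
  assumes M: "smooth_manifold M" and c: "(U, c) \<in> atlas M" "p \<in> U"
  shows "tangent_space M p = range (chart_tangent M p U c)"
proof -
  have "velocity M p \<gamma> \<in> range (chart_tangent M p U c)" if "smooth_curve_at M p \<gamma>" for \<gamma>
    using velocity_eq_chart_tangent[OF M c] that by (auto simp: smooth_curve_at_iff)
  moreover have "chart_tangent M p U c w \<in> tangent_space M p" for w
  proof -
    note s = smooth_curve_in_chart_direction[OF M c, of w]
    define \<gamma> where "\<gamma> = (\<lambda>t::real. inv_into U c (c p + t *\<^sub>R w))"
    have "smooth_curve_at M p \<gamma>" unfolding smooth_curve_at_iff \<gamma>_def using s by simp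
    moreover have "velocity M p \<gamma> = chart_tangent M p U c w"
      unfolding \<gamma>_def velocity_eq_chart_tangent[OF M c s(1,2)] s(3) ..
    ultimately show ?thesis unfolding tangent_space_def by (intro CollectI exI[of _ \<gamma>]) simp
  qed
  ultimately show ?thesis unfolding tangent_space_def by auto
qed

context
  fixes M :: "('a, 'e::real_normed_vector) mfd" and p :: 'a
  assumes M: "smooth_manifold M" and p: "p \<in> topspace (mtop M)"
begin

lemma tangent_chart_representation:
  obtains U c where "(U, c) \<in> atlas M" "p \<in> U" "tangent_space M p = range (chart_tangent M p U c)"
    "\<And>f. smooth_fun_near M p f \<Longrightarrow> smooth_at vec_mfd vec_mfd (c p) (f \<circ> inv_into U c)"
proof -
  obtain U c where c: "(U, c) \<in> atlas M" "p \<in> U"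
    using chart_at[OF charted_if_smooth_manifold[OF M] p] .
  show ?thesis
  proof (rule that[OF c tangent_space_eq_range_chart_tangent[OF M c]])
    show "smooth_at vec_mfd vec_mfd (c p) (f \<circ> inv_into U c)" if "smooth_fun_near M p f" for f
      using smooth_at_fun_in_chart[OF M c] that unfolding smooth_fun_near_iff .
  qed
qed

lemma tangent_eq_0: "u \<in> tangent_space M p \<Longrightarrow> \<not> smooth_fun_near M p f \<Longrightarrow> u f = 0"
  by (auto simp: tangent_space_def velocity_def)

lemma tangent_space_add:
  assumes "u \<in> tangent_space M p" "v \<in> tangent_space M p"
  shows "(\<lambda>f. u f + v f) \<in> tangent_space M p"
proof -
  obtain U c where c: "(U, c) \<in> atlas M" "p \<in> U"
    "tangent_space M p = range (chart_tangent M p U c)"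
    "\<And>f. smooth_fun_near M p f \<Longrightarrow> smooth_at vec_mfd vec_mfd (c p) (f \<circ> inv_into U c)"
    by (rule tangent_chart_representation) (rule that)
  obtain w z where wz: "u = chart_tangent M p U c w" "v = chart_tangent M p U c z"
    using assms c(3) by auto
  have "(\<lambda>f. u f + v f) = chart_tangent M p U c (w + z)"
    unfolding wz chart_tangent_def
    by (auto simp: fun_eq_iff linear_add linear_frechet_derivative[OF smooth_at_differentiable[OF c(4)]])
  then show ?thesis using c(3) by auto
qed

lemma tangent_space_scale:
  assumes "u \<in> tangent_space M p"
  shows "(\<lambda>f. r * u f) \<in> tangent_space M p"
proof -
  obtain U c where c: "(U, c) \<in> atlas M" "p \<in> U"
    "tangent_space M p = range (chart_tangent M p U c)"
    "\<And>f. smooth_fun_near M p f \<Longrightarrow> smooth_at vec_mfd vec_mfd (c p) (f \<circ> inv_into U c)"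
    by (rule tangent_chart_representation) (rule that)
  obtain w where w: "u = chart_tangent M p U c w"
    using assms c(3) by auto
  have "(\<lambda>f. r * u f) = chart_tangent M p U c (r *\<^sub>R w)"
    unfolding w chart_tangent_def
    by (auto simp: fun_eq_iff linear_cmul linear_frechet_derivative[OF smooth_at_differentiable[OF c(4)]])
  then show ?thesis using c(3) by auto
qed

lemma tangent_space_0: "(\<lambda>f. 0) \<in> tangent_space M p"
proof -
  obtain U c where "tangent_space M p = range (chart_tangent M p U c)"
    by (rule tangent_chart_representation)
  then have "chart_tangent M p U c 0 \<in> tangent_space M p" by simp
  from tangent_space_scale[OF this, of 0] show ?thesis by simp
qed

text \<open>Both the smoothness of \<open>f\<close> near \<open>p\<close> and the derivative along a curve depend only on the germ
  of \<open>f\<close>.\<close>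

lemma tangent_local:
  assumes u: "u \<in> tangent_space M p" and W: "openin (mtop M) W" "p \<in> W" "\<And>x. x \<in> W \<Longrightarrow> f x = g x"
  shows "u f = u g"
proof -
  note ch = charted_if_smooth_manifold[OF M]
  obtain \<gamma> where \<gamma>: "u = velocity M p \<gamma>" "\<gamma> 0 = p" "smooth_at vec_mfd M 0 \<gamma>"
    using u by (auto simp: tangent_space_def smooth_curve_at_iff)
  have near: "smooth_fun_near M p f \<longleftrightarrow> smooth_fun_near M p g"
    unfolding smooth_fun_near_iff
    using smooth_at_cong[OF ch charted_euclidean _ W(1,2)] W(3) by metis
  obtain J where J: "openin (mtop vec_mfd) J" "0 \<in> J" "\<And>t. t \<in> J \<Longrightarrow> \<gamma> t \<in> W"
    using smooth_at_preimage[OF \<gamma>(3) W(1)] \<gamma>(2) W(2) by metis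
  have "deriv (\<lambda>t. f (\<gamma> t)) 0 = deriv (\<lambda>t. g (\<gamma> t)) 0"
  proof (rule deriv_cong_ev[OF _ refl])
    show "\<forall>\<^sub>F t in nhds 0. f (\<gamma> t) = g (\<gamma> t)"
      using J W(3) by (auto simp: eventually_nhds vec_mfd_def)
  qed
  then show ?thesis using near by (simp add: \<gamma>(1) velocity_def)
qed

lemma smooth_fun_near_add:
  assumes "smooth_fun_near M p f" "smooth_fun_near M p g"
  shows "smooth_fun_near M p (\<lambda>x. a * f x + b * g x)"
proof -
  have "bounded_linear (\<lambda>z::real \<times> real. a * fst z + b * snd z)"
    by (intro bounded_linear_add bounded_linear_const_mult bounded_linear_fst bounded_linear_snd)
  from smooth_at_compose[OF charted_if_smooth_manifold[OF M] charted_euclidean charted_euclidean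
      smooth_at_Pair_vec[OF charted_if_smooth_manifold[OF M]] smooth_at_bounded_linear[OF this]]
  show ?thesis using assms unfolding smooth_fun_near_iff by simp
qed

lemma tangent_linear:
  assumes u: "u \<in> tangent_space M p" and fg: "smooth_fun_near M p f" "smooth_fun_near M p g"
  shows "u (\<lambda>x. a * f x + b * g x) = a * u f + b * u g"
proof -
  obtain U c where c: "(U, c) \<in> atlas M" "p \<in> U"
    "tangent_space M p = range (chart_tangent M p U c)"
    "\<And>f. smooth_fun_near M p f \<Longrightarrow> smooth_at vec_mfd vec_mfd (c p) (f \<circ> inv_into U c)"
    by (rule tangent_chart_representation) (rule that)
  obtain w where w: "u = chart_tangent M p U c w"
    using u c(3) by auto
  have "((\<lambda>y. a * (f \<circ> inv_into U c) y + b * (g \<circ> inv_into U c) y) has_derivative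
     (\<lambda>h. a * frechet_derivative (f \<circ> inv_into U c) (at (c p)) h
        + b * frechet_derivative (g \<circ> inv_into U c) (at (c p)) h)) (at (c p))"
    by (intro has_derivative_add has_derivative_mult_right smooth_at_has_derivative c(4) fg)
  from frechet_derivative_eqI[OF this] show ?thesis
    using fg smooth_fun_near_add[OF fg] by (simp add: w chart_tangent_def comp_def)
qed

lemma tangent_diff:
  assumes "u \<in> tangent_space M p" "smooth_fun_near M p f" "smooth_fun_near M p g"
  shows "u (\<lambda>x. f x - g x) = u f - u g"
  using tangent_linear[OF assms, of 1 "-1"] by simp

end

section \<open>Mixed derivatives of real functions\<close>

text \<open>Relates the two kinds of partial derivative in use: the Frechet derivative in a coordinate
  direction, which is smooth in the base point, and the derivative of a function of one real variable, which computes
  velocities.\<close>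

lemma partial_derivative_second:
  fixes f :: "'e::real_normed_vector \<times> real \<Rightarrow> real"
  assumes "(f has_derivative f') (at (x, t))"
  shows "((\<lambda>t. f (x, t)) has_real_derivative f' (0, 1)) (at t)"
proof -
  have "((\<lambda>t. (x, t)) has_derivative (\<lambda>h. (0, h))) (at t)"
    by (intro derivative_intros)
  from has_derivative_compose[OF this assms]
  have "((\<lambda>t. f (x, t)) has_derivative (\<lambda>h. f' (0, h))) (at t)" .
  moreover have "(\<lambda>h. f' (0, h)) = (*) (f' (0, 1))"
  proof
    fix h
    have "f' (0, h) = f' (h *\<^sub>R (0, 1))" by simp
    also have "\<dots> = h *\<^sub>R f' (0, 1)" by (rule linear_cmul[OF has_derivative_linear[OF assms]])
    finally show "f' (0, h) = f' (0, 1) * h" by simp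
  qed
  ultimately show ?thesis unfolding has_field_derivative_def by simp
qed

lemma partial_derivative_first:
  fixes f :: "real \<times> 'e::real_normed_vector \<Rightarrow> real"
  assumes "(f has_derivative f') (at (s, x))"
  shows "((\<lambda>s. f (s, x)) has_real_derivative f' (1, 0)) (at s)"
proof -
  have "((\<lambda>s. (s, x)) has_derivative (\<lambda>h. (h, 0))) (at s)"
    by (intro derivative_intros)
  from has_derivative_compose[OF this assms]
  have "((\<lambda>s. f (s, x)) has_derivative (\<lambda>h. f' (h, 0))) (at s)" .
  moreover have "(\<lambda>h. f' (h, 0)) = (*) (f' (1, 0))"
  proof
    fix h
    have "f' (h, 0) = f' (h *\<^sub>R (1, 0))" by simp
    also have "\<dots> = h *\<^sub>R f' (1, 0)" by (rule linear_cmul[OF has_derivative_linear[OF assms]])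
    finally show "f' (h, 0) = f' (1, 0) * h" by simp
  qed
  ultimately show ?thesis unfolding has_field_derivative_def by simp
qed

lemma smooth_on_imp_smooth_at:
  "open S \<Longrightarrow> smooth_on S f \<Longrightarrow> x \<in> S \<Longrightarrow> smooth_at vec_mfd vec_mfd x f"
  unfolding smooth_at_vec_iff by blast

text \<open>Near \<open>x\<close> the partial derivative is a directional derivative of a smooth map, restricted to the
  slice \<open>t = 0\<close>.\<close>

lemma smooth_at_deriv_second:
  fixes f :: "'e::real_normed_vector \<times> real \<Rightarrow> real"
  assumes E: "finite_dim TYPE('e)" and f: "smooth_at vec_mfd vec_mfd (x, 0) f"
  shows "smooth_at vec_mfd vec_mfd x (\<lambda>y. deriv (\<lambda>t. f (y, t)) 0)"
proof -
  note chE = charted_vec[OF E]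
  note chE2 = charted_vec[OF finite_dim_prod[OF E finite_dim_euclidean]]
  obtain S where S: "open S" "(x, 0) \<in> S" "smooth_on S f"
    using f unfolding smooth_at_vec_iff by blast
  have lin: "bounded_linear (\<lambda>y::'e. (y, 0::real))"
    by (intro bounded_linear_Pair bounded_linear_ident bounded_linear_zero)
  have sm: "smooth_at vec_mfd vec_mfd x (\<lambda>y. frechet_derivative f (at (y, 0)) (0, 1))"
    by (rule smooth_at_compose[OF chE chE2 charted_euclidean smooth_at_bounded_linear[OF lin]
          smooth_at_directional_derivative[OF f]])
  have "open ((\<lambda>y. (y, 0)) -` S)"
    by (rule open_vimage[OF S(1)]) (intro continuous_intros)
  moreover have "frechet_derivative f (at (y, 0)) (0, 1) = deriv (\<lambda>t. f (y, t)) 0" if "(y, 0) \<in> S" for y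
    using DERIV_imp_deriv[OF partial_derivative_second[OF smooth_at_has_derivative]]
      smooth_on_imp_smooth_at[OF S(1,3) that] by metis
  ultimately show ?thesis
    by (intro smooth_at_cong[OF chE charted_euclidean sm, where V = "(\<lambda>y. (y, 0)) -` S"])
      (use S(2) in \<open>auto simp: vec_mfd_def\<close>)
qed

text \<open>The mean value theorem in the second variable for \<open>\<lambda>t. f (h, t) - f (0, t)\<close>, and then in the first
  variable for the partial derivative.\<close>

lemma mean_value_square:
  fixes f :: "real \<times> real \<Rightarrow> real"
  assumes h: "h > 0"
    and f: "\<And>x. x \<in> {0..h} \<times> {0..h} \<Longrightarrow> (f has_derivative f' x) (at x)"
    and g: "\<And>x. x \<in> {0..h} \<times> {0..h} \<Longrightarrow> ((\<lambda>x. f' x (0, 1)) has_derivative g x) (at x)"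
  shows "\<exists>x \<in> {0..h} \<times> {0..h}. f (h, h) - f (0, h) - f (h, 0) + f (0, 0) = h * h * g x (1, 0)"
proof -
  have "\<And>t. 0 \<le> t \<Longrightarrow> t \<le> h \<Longrightarrow>
      ((\<lambda>t. f (h, t) - f (0, t)) has_real_derivative f' (h, t) (0, 1) - f' (0, t) (0, 1)) (at t)"
    by (intro DERIV_diff partial_derivative_second f) (use h in auto)
  from MVT2[OF h this] obtain t where t: "0 < t" "t < h"
    "f (h, h) - f (0, h) - (f (h, 0) - f (0, 0)) = (h - 0) * (f' (h, t) (0, 1) - f' (0, t) (0, 1))"
    by blast
  have "\<And>s. 0 \<le> s \<Longrightarrow> s \<le> h \<Longrightarrow>
      ((\<lambda>s. f' (s, t) (0, 1)) has_real_derivative g (s, t) (1, 0)) (at s)"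
    by (intro partial_derivative_first g) (use t in auto)
  from MVT2[OF h this] obtain s where s: "0 < s" "s < h"
    "f' (h, t) (0, 1) - f' (0, t) (0, 1) = (h - 0) * g (s, t) (1, 0)"
    by blast
  show ?thesis
    by (rule bexI[of _ "(s, t)"]) (use s t in \<open>auto simp: algebra_simps\<close>)
qed

text \<open>The second difference of \<open>f\<close> over the square with side \<open>h\<close> is symmetric in the two variables.
  By the mean value theorem it equals \<open>h\<^sup>2\<close> times either mixed derivative at some point of the square, and both are
  continuous.\<close>

lemma symmetric_mixed_derivative:
  fixes f :: "real \<times> real \<Rightarrow> real"
  assumes f: "smooth_at vec_mfd vec_mfd (0, 0) f"
  shows "frechet_derivative (\<lambda>x. frechet_derivative f (at x) (0, 1)) (at (0, 0)) (1, 0) =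
         frechet_derivative (\<lambda>x. frechet_derivative f (at x) (1, 0)) (at (0, 0)) (0, 1)"
proof (rule ccontr)
  define f1 where "f1 = (\<lambda>x. frechet_derivative f (at x) (1, 0))"
  define f2 where "f2 = (\<lambda>x. frechet_derivative f (at x) (0, 1))"
  define f12 where "f12 = (\<lambda>x. frechet_derivative f2 (at x) (1, 0))"
  define f21 where "f21 = (\<lambda>x. frechet_derivative f1 (at x) (0, 1))"
  assume "\<not> ?thesis"
  then have ne: "f12 (0, 0) \<noteq> f21 (0, 0)" by (simp add: f12_def f21_def f1_def f2_def)
  define e where "e = \<bar>f12 (0, 0) - f21 (0, 0)\<bar> / 2"
  have e: "e > 0" using ne by (simp add: e_def)
  obtain S where S: "open S" "(0, 0) \<in> S" "\<And>k. Ck_on k S f"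
    using f unfolding smooth_at_vec_iff smooth_on_def by blast
  have C1: "Ck_on (Suc (Suc 0)) S f" "Ck_on (Suc 0) S f1" "Ck_on (Suc 0) S f2"
    using S(3)[of "Suc (Suc 0)"] by (simp_all add: f1_def f2_def)
  have C0: "continuous_on S f12" "continuous_on S f21"
    using C1 by (simp_all add: f12_def f21_def)
  have "isCont f12 (0, 0)" "isCont f21 (0, 0)"
    using C0 S(1,2) by (simp_all add: continuous_on_eq_continuous_at)
  then obtain d1 d2 where d1: "d1 > 0" "\<And>x. dist x (0, 0) < d1 \<Longrightarrow> dist (f12 x) (f12 (0, 0)) < e"
    and d2: "d2 > 0" "\<And>x. dist x (0, 0) < d2 \<Longrightarrow> dist (f21 x) (f21 (0, 0)) < e"
    using e unfolding continuous_at_eps_delta by metis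
  obtain d3 where d3: "d3 > 0" "ball (0, 0) d3 \<subseteq> S"
    using S(1,2) open_contains_ball by blast
  \<comment> \<open>points of the square have norm at most \<open>2 * h\<close>, strictly less than each of the three radii\<close>
  define h where "h = min d1 (min d2 d3) / 3"
  have h: "h > 0" using d1 d2 d3 by (simp add: h_def)
  have near: "dist x (0, 0) < d1 \<and> dist x (0, 0) < d2 \<and> x \<in> S" if xh: "x \<in> {0..h} \<times> {0..h}" for x
  proof -
    obtain s t where x: "x = (s, t)" "0 \<le> s" "s \<le> h" "0 \<le> t" "t \<le> h"
      using xh by auto
    have "dist x (0, 0) \<le> \<bar>s\<bar> + \<bar>t\<bar>"
      unfolding x dist_norm using norm_Pair_le[of s t] by simp
    then have "dist x (0, 0) < 3 * h" using x h by simp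
    then have "dist x (0, 0) < min d1 (min d2 d3)" by (simp add: h_def)
    then show ?thesis using d3(2) by (auto simp: dist_commute)
  qed
  have "\<exists>x \<in> {0..h} \<times> {0..h}. f (h, h) - f (0, h) - f (h, 0) + f (0, 0)
      = h * h * frechet_derivative f2 (at x) (1, 0)"
    by (rule mean_value_square[OF h, where f' = "\<lambda>x. frechet_derivative f (at x)"])
      (use near Ck_on_has_derivative[OF C1(1)] Ck_on_has_derivative[OF C1(3)] in \<open>auto simp: f2_def\<close>)
  then obtain x where x: "x \<in> {0..h} \<times> {0..h}"
    "f (h, h) - f (0, h) - f (h, 0) + f (0, 0) = h * h * f12 x"
    by (auto simp: f12_def)
  have swap: "(prod.swap has_derivative prod.swap) (at z)" for z :: "real \<times> real"
    unfolding prod.swap_def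
    by (intro bounded_linear_imp_has_derivative bounded_linear_Pair bounded_linear_fst bounded_linear_snd)
  \<comment> \<open>the same square with the variables exchanged yields the other mixed derivative\<close>
  have "\<exists>x \<in> {0..h} \<times> {0..h}. (f \<circ> prod.swap) (h, h) - (f \<circ> prod.swap) (0, h)
      - (f \<circ> prod.swap) (h, 0) + (f \<circ> prod.swap) (0, 0)
      = h * h * (frechet_derivative f1 (at (prod.swap x)) \<circ> prod.swap) (1, 0)"
  proof (rule mean_value_square[OF h, where f' = "\<lambda>x. frechet_derivative f (at (prod.swap x)) \<circ> prod.swap"])
    fix x :: "real \<times> real" assume "x \<in> {0..h} \<times> {0..h}"
    then have "prod.swap x \<in> S" using near[of "prod.swap x"] by auto
    from Ck_on_has_derivative[OF C1(1) this] Ck_on_has_derivative[OF C1(2) this]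
    show "((f \<circ> prod.swap) has_derivative frechet_derivative f (at (prod.swap x)) \<circ> prod.swap) (at x)"
      "((\<lambda>x. (frechet_derivative f (at (prod.swap x)) \<circ> prod.swap) (0, 1)) has_derivative
         frechet_derivative f1 (at (prod.swap x)) \<circ> prod.swap) (at x)"
      using has_derivative_compose[OF swap, of f] has_derivative_compose[OF swap, of f1]
      by (auto simp: f1_def comp_def)
  qed
  then obtain y where y: "y \<in> {0..h} \<times> {0..h}"
    "f (h, h) - f (h, 0) - f (0, h) + f (0, 0) = h * h * f21 (prod.swap y)"
    by (auto simp: f21_def)
  then have y': "prod.swap y \<in> {0..h} \<times> {0..h}" by auto
  have "h * h * f12 x = h * h * f21 (prod.swap y)"
    unfolding x(2)[symmetric] y(2)[symmetric] by simp
  then have "f12 x = f21 (prod.swap y)" using h by simp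
  moreover have "\<bar>f12 (0, 0) - f21 (0, 0)\<bar> \<le> \<bar>f12 x - f12 (0, 0)\<bar> + \<bar>f12 x - f21 (0, 0)\<bar>"
    by linarith
  moreover have "\<bar>f12 x - f12 (0, 0)\<bar> < e" "\<bar>f21 (prod.swap y) - f21 (0, 0)\<bar> < e"
    using d1(2)[of x] d2(2)[of "prod.swap y"] near[OF x(1)] near[OF y'] by (simp_all add: dist_real_def)
  ultimately show False by (simp add: e_def)
qed

text \<open>The derivative \<open>\<partial>\<^sub>s\<partial>\<^sub>t K(s,t)\<close> at the origin. Iterating velocities along two curves produces such
  derivatives, so the Lie bracket reduces to them.\<close>

definition mixed_deriv :: "(real \<Rightarrow> real \<Rightarrow> real) \<Rightarrow> real" where
  "mixed_deriv K = deriv (\<lambda>s. deriv (K s) 0) 0"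

lemma smooth_at_deriv_inner:
  fixes K :: "real \<Rightarrow> real \<Rightarrow> real"
  assumes K: "smooth_at vec_mfd vec_mfd (0, 0) (\<lambda>(s, t). K s t)"
  shows "smooth_at vec_mfd vec_mfd 0 (\<lambda>s. deriv (K s) 0)"
  using smooth_at_deriv_second[OF finite_dim_euclidean K] by simp

lemma smooth_at_real_DERIV:
  fixes g :: "real \<Rightarrow> real"
  assumes "smooth_at vec_mfd vec_mfd x g"
  shows "(g has_real_derivative deriv g x) (at x)"
  using smooth_at_differentiable[OF assms]
  by (simp add: DERIV_deriv_iff_real_differentiable)

lemma mixed_deriv_eq_frechet:
  fixes K :: "real \<Rightarrow> real \<Rightarrow> real"
  assumes K: "smooth_at vec_mfd vec_mfd (0, 0) (\<lambda>(s, t). K s t)"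
  shows "mixed_deriv K = frechet_derivative
     (\<lambda>x. frechet_derivative (\<lambda>(s, t). K s t) (at x) (0, 1)) (at (0, 0)) (1, 0)"
proof -
  obtain S where S: "open S" "(0, 0) \<in> S" "smooth_on S (\<lambda>(s, t). K s t)"
    using K unfolding smooth_at_vec_iff by blast
  let ?f2 = "\<lambda>x. frechet_derivative (\<lambda>(s, t). K s t) (at x) (0, 1)"
  have eq: "?f2 (s, 0) = deriv (K s) 0" if "(s, 0) \<in> S" for s
    using DERIV_imp_deriv[OF partial_derivative_second[OF smooth_at_has_derivative[
      OF smooth_on_imp_smooth_at[OF S(1,3) that]]]] by simp
  have o: "open ((\<lambda>s. (s, 0)) -` S)"
    by (rule open_vimage[OF S(1)]) (intro continuous_intros)
  have "((\<lambda>s. ?f2 (s, 0)) has_real_derivative frechet_derivative ?f2 (at (0, 0)) (1, 0)) (at 0)"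
    by (rule partial_derivative_first[OF smooth_at_has_derivative[OF smooth_at_directional_derivative[OF K]]])
  then have "((\<lambda>s. deriv (K s) 0) has_real_derivative frechet_derivative ?f2 (at (0, 0)) (1, 0)) (at 0)"
    by (rule has_field_derivative_transform_within_open[OF _ o]) (use S(2) eq in auto)
  then show ?thesis unfolding mixed_deriv_def by (rule DERIV_imp_deriv)
qed

lemma mixed_deriv_swap:
  fixes K :: "real \<Rightarrow> real \<Rightarrow> real"
  assumes K: "smooth_at vec_mfd vec_mfd (0, 0) (\<lambda>(s, t). K s t)"
  shows "mixed_deriv (\<lambda>s t. K t s) = mixed_deriv K"
proof -
  let ?f = "\<lambda>(s, t). K s t"
  obtain S where S: "open S" "(0, 0) \<in> S" "smooth_on S (\<lambda>(s, t). K s t)"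
    using K unfolding smooth_at_vec_iff by blast
  let ?f1 = "\<lambda>x. frechet_derivative ?f (at x) (1, 0)"
  have eq: "?f1 (0, t) = deriv (\<lambda>s. K s t) 0" if "(0, t) \<in> S" for t
    using DERIV_imp_deriv[OF partial_derivative_first[OF smooth_at_has_derivative[
      OF smooth_on_imp_smooth_at[OF S(1,3) that]]]] by simp
  have o: "open ((\<lambda>t. (0, t)) -` S)"
    by (rule open_vimage[OF S(1)]) (intro continuous_intros)
  have "((\<lambda>t. ?f1 (0, t)) has_real_derivative frechet_derivative ?f1 (at (0, 0)) (0, 1)) (at 0)"
    by (rule partial_derivative_second[OF smooth_at_has_derivative[OF smooth_at_directional_derivative[OF K]]])
  then have "((\<lambda>t. deriv (\<lambda>s. K s t) 0) has_real_derivative frechet_derivative ?f1 (at (0, 0)) (0, 1)) (at 0)"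
    by (rule has_field_derivative_transform_within_open[OF _ o]) (use S(2) eq in auto)
  then have "mixed_deriv (\<lambda>s t. K t s) = frechet_derivative ?f1 (at (0, 0)) (0, 1)"
    unfolding mixed_deriv_def by (rule DERIV_imp_deriv)
  then show ?thesis
    using symmetric_mixed_derivative[OF K] mixed_deriv_eq_frechet[OF K] by simp
qed

text \<open>The inner derivative \<open>g(r, s) = \<partial>\<^sub>t L(r, s, t)\<close> at \<open>t = 0\<close> is smooth, and the derivative of \<open>g\<close> in
  the diagonal direction is the sum of its two partial derivatives.\<close>

lemma mixed_deriv_diagonal:
  fixes L :: "real \<Rightarrow> real \<Rightarrow> real \<Rightarrow> real"
  assumes L: "smooth_at vec_mfd vec_mfd ((0, 0), 0) (\<lambda>((r, s), t). L r s t)"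
  shows "mixed_deriv (\<lambda>s t. L s s t) = mixed_deriv (\<lambda>s t. L s 0 t) + mixed_deriv (\<lambda>s t. L 0 s t)"
proof -
  define g where "g = (\<lambda>(r, s). deriv (L r s) 0)"
  have "smooth_at vec_mfd vec_mfd (0, 0) g"
    using smooth_at_deriv_second[OF finite_dim_euclidean L] by (simp add: g_def split_def)
  then have g: "(g has_derivative frechet_derivative g (at (0, 0))) (at (0, 0))"
    by (rule smooth_at_has_derivative)
  let ?D = "frechet_derivative g (at (0, 0))"
  have "((\<lambda>s. (s, s)) has_derivative (\<lambda>h. (h, h))) (at (0::real))"
    by (intro derivative_intros)
  from has_derivative_compose[OF this g]
  have "((\<lambda>s. g (s, s)) has_derivative (\<lambda>h. ?D (h, h))) (at 0)" .
  moreover have "(\<lambda>h. ?D (h, h)) = (*) (?D (1, 0) + ?D (0, 1))"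
  proof
    fix h
    have "?D (h, h) = ?D (h *\<^sub>R (1, 0) + h *\<^sub>R (0, 1))" by simp
    also have "\<dots> = h *\<^sub>R ?D (1, 0) + h *\<^sub>R ?D (0, 1)"
      using has_derivative_linear[OF g] by (simp only: linear_add linear_cmul)
    finally show "?D (h, h) = (?D (1, 0) + ?D (0, 1)) * h" by (simp add: algebra_simps)
  qed
  ultimately have "((\<lambda>s. g (s, s)) has_real_derivative ?D (1, 0) + ?D (0, 1)) (at 0)"
    unfolding has_field_derivative_def by simp
  from DERIV_imp_deriv[OF this] DERIV_imp_deriv[OF partial_derivative_first[OF g]]
    DERIV_imp_deriv[OF partial_derivative_second[OF g]]
  show ?thesis by (simp add: mixed_deriv_def g_def)
qed

lemma frechet_derivative_expand:
  fixes F :: "'e::real_normed_vector \<Rightarrow> real"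
  assumes "F differentiable (at x)" and "w = (\<Sum>b\<in>B. k b *\<^sub>R b)"
  shows "frechet_derivative F (at x) w = (\<Sum>b\<in>B. k b * frechet_derivative F (at x) b)"
  using linear_frechet_derivative[OF assms(1)] by (simp add: assms(2) linear_sum linear_cmul)

lemma deriv_second_compose:
  fixes P :: "real \<times> real \<Rightarrow> 'e::real_normed_vector" and F :: "'e \<Rightarrow> real"
  assumes P: "smooth_at vec_mfd vec_mfd (s, 0) P" and F: "smooth_at vec_mfd vec_mfd (P (s, 0)) F"
  shows "deriv (\<lambda>t. F (P (s, t))) 0
    = frechet_derivative F (at (P (s, 0))) (frechet_derivative P (at (s, 0)) (0, 1))"
  by (rule DERIV_imp_deriv[OF partial_derivative_second])
    (rule has_derivative_compose[OF smooth_at_has_derivative[OF P] smooth_at_has_derivative[OF F]])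

text \<open>The inner derivatives of \<open>F \<circ> P\<close> and \<open>F \<circ> Q\<close> at \<open>(s, 0)\<close> are taken at the same point \<open>P (s, 0)\<close> and
  differ by \<open>DF (P (s, 0)) (\<delta> s)\<close> with \<open>\<delta> = p - q\<close>, where \<open>p s\<close> and \<open>q s\<close>
  are the derivatives of \<open>P\<close> and \<open>Q\<close> at \<open>(s, 0)\<close> in the second variable. As \<open>P\<close> and \<open>Q\<close> agree on the second axis, \<open>\<delta> 0 = 0\<close>, so
  differentiating in \<open>s\<close> leaves only \<open>DF (P (0, 0)) (\<delta>' 0)\<close>: the second derivative of \<open>F\<close> does not contribute.
  The vector \<open>w = \<delta>' 0\<close> is the same for all \<open>F\<close>, which later exhibits the Lie bracket as a tangent
  vector.\<close>

lemma mixed_deriv_diff_eq_frechet: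
  fixes P Q :: "real \<times> real \<Rightarrow> 'e::real_normed_vector"
  assumes E: "finite_dim TYPE('e)"
    and P: "smooth_at vec_mfd vec_mfd (0, 0) P" and Q: "smooth_at vec_mfd vec_mfd (0, 0) Q"
    and axes: "\<And>s. P (s, 0) = Q (s, 0)" "\<And>t. P (0, t) = Q (0, t)"
  obtains w where "\<And>F :: 'e \<Rightarrow> real. smooth_at vec_mfd vec_mfd (P (0, 0)) F \<Longrightarrow>
    mixed_deriv (\<lambda>s t. F (P (s, t))) - mixed_deriv (\<lambda>s t. F (Q (s, t)))
      = frechet_derivative F (at (P (0, 0))) w"
proof -
  note chE = charted_vec[OF E]
  define p where "p = (\<lambda>s. frechet_derivative P (at (s, 0)) (0, 1))"
  define q where "q = (\<lambda>s. frechet_derivative Q (at (s, 0)) (0, 1))"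
  have lin: "bounded_linear (\<lambda>s::real. (s, 0::real))"
    by (intro bounded_linear_Pair bounded_linear_ident bounded_linear_zero)
  have lin_at: "smooth_at vec_mfd vec_mfd (0::real) (\<lambda>s. (s, 0::real))"
    by (rule smooth_at_bounded_linear[OF lin])
  have "smooth_at vec_mfd vec_mfd 0 p" "smooth_at vec_mfd vec_mfd 0 q"
    unfolding p_def q_def
    by (rule smooth_at_euclidean_compose[OF lin_at smooth_at_directional_derivative[OF P] chE],
        rule smooth_at_euclidean_compose[OF lin_at smooth_at_directional_derivative[OF Q] chE])
  then have "(\<lambda>s. p s - q s) differentiable (at 0)"
    by (intro differentiable_diff smooth_at_differentiable)
  then obtain w where w: "((\<lambda>s. p s - q s) has_vector_derivative w) (at 0)"
    using vector_derivative_works by blast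
  have v: "((\<lambda>t::real. (0::real, t)) has_derivative (\<lambda>h. (0, h))) (at 0)"
    by (intro derivative_intros)
  have "(\<lambda>h. frechet_derivative P (at (0, 0)) (0, h)) = (\<lambda>h. frechet_derivative Q (at (0, 0)) (0, h))"
    using has_derivative_compose[OF v smooth_at_has_derivative[OF P]]
      has_derivative_compose[OF v smooth_at_has_derivative[OF Q]] axes(2)
    by (intro has_derivative_unique[of "\<lambda>t. P (0, t)"]) auto
  then have pq0: "p 0 - q 0 = 0" unfolding p_def q_def by (metis diff_self)
  obtain B :: "'e set" and \<kappa> where B: "finite B" "\<And>b. b \<in> B \<Longrightarrow> bounded_linear (\<kappa> b)"
    "\<And>x. x = (\<Sum>b\<in>B. \<kappa> b x *\<^sub>R b)"
    using finite_dim_coordinates[OF E] by blast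
  have "mixed_deriv (\<lambda>s t. F (P (s, t))) - mixed_deriv (\<lambda>s t. F (Q (s, t)))
      = frechet_derivative F (at (P (0, 0))) w"
    if F: "smooth_at vec_mfd vec_mfd (P (0, 0)) F" for F :: "'e \<Rightarrow> real"
  proof -
    define DF where "DF = (\<lambda>x. frechet_derivative F (at x))"
    have P0: "smooth_at vec_mfd vec_mfd 0 (\<lambda>s::real. P (s, 0))"
      by (rule smooth_at_euclidean_compose[OF lin_at P chE])
    have DFb: "((\<lambda>s. DF (P (s, 0)) b) has_real_derivative deriv (\<lambda>s. DF (P (s, 0)) b) 0) (at 0)" for b
      unfolding DF_def
      by (rule smooth_at_real_DERIV) (rule smooth_at_compose[OF charted_euclidean chE charted_euclidean P0
          smooth_at_directional_derivative[OF F]])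
    have \<kappa>w: "((\<lambda>s. \<kappa> b (p s - q s)) has_real_derivative \<kappa> b w) (at 0)" if "b \<in> B" for b
      using bounded_linear.has_vector_derivative[OF B(2)[OF that] w]
      by (simp add: has_real_derivative_iff_has_vector_derivative)
    \<comment> \<open>the product rule; the terms with a derivative of \<open>DF\<close> carry the factor \<open>\<kappa> b (p 0 - q 0) = 0\<close>\<close>
    have "((\<lambda>s. \<Sum>b\<in>B. \<kappa> b (p s - q s) * DF (P (s, 0)) b) has_real_derivative
        (\<Sum>b\<in>B. \<kappa> b w * DF (P (0, 0)) b + deriv (\<lambda>s. DF (P (s, 0)) b) 0 * \<kappa> b (p 0 - q 0))) (at 0)"
      by (intro DERIV_sum DERIV_mult \<kappa>w DFb)
    moreover have "\<kappa> b (p 0 - q 0) = 0" if "b \<in> B" for b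
      unfolding pq0 by (rule linear_0[OF bounded_linear.linear[OF B(2)[OF that]]])
    moreover have "(\<Sum>b\<in>B. \<kappa> b w * DF (P (0, 0)) b) = DF (P (0, 0)) w"
      unfolding DF_def by (rule frechet_derivative_expand[symmetric, OF smooth_at_differentiable[OF F] B(3)])
    ultimately have D: "((\<lambda>s. \<Sum>b\<in>B. \<kappa> b (p s - q s) * DF (P (s, 0)) b) has_real_derivative
        DF (P (0, 0)) w) (at 0)"
      by simp
    obtain S where S: "open S" "P (0, 0) \<in> S" "smooth_on S F"
      using F unfolding smooth_at_vec_iff by blast
    obtain SP where SP: "open SP" "(0, 0) \<in> SP" "smooth_on SP P"
      using P unfolding smooth_at_vec_iff by blast
    obtain SQ where SQ: "open SQ" "(0, 0) \<in> SQ" "smooth_on SQ Q"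
      using Q unfolding smooth_at_vec_iff by blast
    have oS: "openin (mtop vec_mfd) S" using S(1) by (simp add: vec_mfd_def)
    obtain J where J: "openin (mtop vec_mfd) J" "0 \<in> J" "\<And>s. s \<in> J \<Longrightarrow> P (s, 0) \<in> S"
      by (rule smooth_at_preimage[OF P0 oS S(2)]) (rule that)
    define J' where "J' = J \<inter> (\<lambda>s. (s, 0)) -` (SP \<inter> SQ)"
    have "open ((\<lambda>s::real. (s, 0::real)) -` (SP \<inter> SQ))"
      by (rule open_vimage[OF open_Int[OF SP(1) SQ(1)]]) (intro continuous_intros)
    then have J': "open J'" "0 \<in> J'"
      using J SP(2) SQ(2) by (auto simp: J'_def vec_mfd_def)
    have eq: "(\<Sum>b\<in>B. \<kappa> b (p s - q s) * DF (P (s, 0)) b)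
        = deriv (\<lambda>t. F (P (s, t))) 0 - deriv (\<lambda>t. F (Q (s, t))) 0" if s: "s \<in> J'" for s
    proof -
      have F': "smooth_at vec_mfd vec_mfd (P (s, 0)) F"
        using s J(3) S by (intro smooth_on_imp_smooth_at[OF S(1,3)]) (auto simp: J'_def)
      have P': "smooth_at vec_mfd vec_mfd (s, 0) P"
        using s by (intro smooth_on_imp_smooth_at[OF SP(1,3)]) (auto simp: J'_def)
      have Q': "smooth_at vec_mfd vec_mfd (s, 0) Q"
        using s by (intro smooth_on_imp_smooth_at[OF SQ(1,3)]) (auto simp: J'_def)
      have "(\<Sum>b\<in>B. \<kappa> b (p s - q s) * DF (P (s, 0)) b) = DF (P (s, 0)) (p s - q s)"
        unfolding DF_def by (rule frechet_derivative_expand[symmetric, OF smooth_at_differentiable[OF F'] B(3)])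
      also have "\<dots> = DF (P (s, 0)) (p s) - DF (P (s, 0)) (q s)"
        unfolding DF_def by (rule linear_diff[OF linear_frechet_derivative[OF smooth_at_differentiable[OF F']]])
      finally show ?thesis
        unfolding DF_def p_def q_def deriv_second_compose[OF P' F']
          deriv_second_compose[OF Q' F'[unfolded axes]] axes(1) .
    qed
    have "((\<lambda>s. deriv (\<lambda>t. F (P (s, t))) 0 - deriv (\<lambda>t. F (Q (s, t))) 0) has_real_derivative
        DF (P (0, 0)) w) (at 0)"
      by (rule has_field_derivative_transform_within_open[OF D J']) (rule eq)
    moreover have "smooth_at vec_mfd vec_mfd (0, 0) (\<lambda>(s, t). F (P (s, t)))"
      "smooth_at vec_mfd vec_mfd (0, 0) (\<lambda>(s, t). F (Q (s, t)))"
      using smooth_at_compose[OF charted_euclidean chE charted_euclidean P F]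
        smooth_at_compose[OF charted_euclidean chE charted_euclidean Q F[unfolded axes]]
      by (simp_all add: case_prod_beta')
    note DERIV_diff[OF smooth_at_real_DERIV[OF smooth_at_deriv_inner[OF this(1)]]
        smooth_at_real_DERIV[OF smooth_at_deriv_inner[OF this(2)]]]
    ultimately show ?thesis
      unfolding mixed_deriv_def DF_def by (rule DERIV_unique[symmetric])
  qed
  then show ?thesis by (rule that)
qed

lemma mixed_deriv_cong:
  assumes "open J" "(0, 0) \<in> J" "\<And>s t. (s, t) \<in> J \<Longrightarrow> K s t = L s t"
  shows "mixed_deriv K = mixed_deriv L"
  unfolding mixed_deriv_def
proof (rule deriv_cong_ev[OF _ refl])
  have "open ((\<lambda>s. (s, 0)) -` J)"
    by (rule open_vimage[OF assms(1)]) (intro continuous_intros)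
  moreover have "deriv (K s) 0 = deriv (L s) 0" if "(s, 0) \<in> J" for s
  proof (rule deriv_cong_ev[OF _ refl])
    have "open ((\<lambda>t. (s, t)) -` J)"
      by (rule open_vimage[OF assms(1)]) (intro continuous_intros)
    then show "\<forall>\<^sub>F t in nhds 0. K s t = L s t"
      unfolding eventually_nhds using assms(3) that by blast
  qed
  ultimately show "\<forall>\<^sub>F s in nhds 0. deriv (K s) 0 = deriv (L s) 0"
    unfolding eventually_nhds using assms(2) by blast
qed

section \<open>Left-invariant vector fields on a Lie group\<close>

locale smooth_group = group G for G :: "('a, 'm) monoid_scheme" (structure) +
  fixes M :: "('a, 'e::real_normed_vector) mfd"
  assumes lie: "lie_group G M"
begin

lemma manifold_M: "smooth_manifold M"
  and topspace_M: "topspace (mtop M) = carrier G"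
  using lie by (simp_all add: lie_group_def)

lemma charted_M: "charted M" by (rule charted_if_smooth_manifold[OF manifold_M])

lemma one_topspace: "\<one> \<in> topspace (mtop M)" by (simp add: topspace_M)

lemma smooth_at_mult:
  assumes X: "charted X" and F: "smooth_at X M p F" and H: "smooth_at X M p H"
  shows "smooth_at X M p (\<lambda>x. F x \<otimes> H x)"
proof -
  have "smooth_map (prod_mfd M M) M (\<lambda>(x, y). x \<otimes> y)"
    using lie by (simp add: lie_group_def)
  moreover have "(F p, H p) \<in> topspace (mtop (prod_mfd M M))"
    using smooth_at_topspace(2)[OF F] smooth_at_topspace(2)[OF H] by (simp add: prod_mfd_def)
  ultimately have "smooth_at (prod_mfd M M) M (F p, H p) (\<lambda>(x, y). x \<otimes> y)"
    by (rule smooth_at_if_smooth_map)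
  from smooth_at_compose[OF X charted_prod[OF charted_M charted_M] charted_M smooth_at_Pair[OF X charted_M charted_M F H] this]
  show ?thesis by simp
qed

lemma smooth_at_inverse:
  assumes X: "charted X" and F: "smooth_at X M p F"
  shows "smooth_at X M p (\<lambda>x. inv (F x))"
proof -
  have "smooth_map M M (\<lambda>x. inv x)"
    using lie unfolding lie_group_def by (elim conjE)
  from smooth_at_compose[OF X charted_M charted_M F smooth_at_if_smooth_map[OF this smooth_at_topspace(2)[OF F]]]
  show ?thesis .
qed

lemma smooth_at_left_translation:
  assumes "q \<in> carrier G" "r \<in> carrier G"
  shows "smooth_at M M r (\<lambda>x. q \<otimes> x)"
  using smooth_at_mult[OF charted_M smooth_at_const[OF charted_M] smooth_at_id[OF manifold_M]] assms
  by (simp add: topspace_M)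

lemma smooth_fun_near_translate:
  assumes "q \<in> carrier G" "r \<in> carrier G" "smooth_fun_near M (q \<otimes> r) f"
  shows "smooth_fun_near M r (\<lambda>x. f (q \<otimes> x))"
  unfolding smooth_fun_near_iff
  by (rule smooth_at_compose[OF charted_M charted_M charted_euclidean smooth_at_left_translation])
    (use assms in \<open>simp_all add: smooth_fun_near_iff\<close>)

abbreviation tangent_at_one ("\<TT>") where "\<TT> \<equiv> tangent_space M \<one>"
abbreviation field_of ("\<LL>") where "\<LL> \<equiv> left_inv_field G M"

lemma field_of_eq:
  assumes "q \<in> carrier G" "smooth_fun_near M q f"
  shows "\<LL> v q f = v (\<lambda>x. f (q \<otimes> x))"
  using assms by (simp add: left_inv_field_def tangent_map_def comp_def)

text \<open>Curves are required to stay in the group for all times and not only near 0, so that the group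
  laws can be applied to their values without restriction.\<close>

definition curve :: "(real \<Rightarrow> 'a) \<Rightarrow> bool" where
  "curve a \<longleftrightarrow> a 0 = \<one> \<and> (\<forall>t. a t \<in> carrier G) \<and> smooth_at vec_mfd M 0 a"

lemma curveD:
  assumes "curve a"
  shows "a 0 = \<one>" "a t \<in> carrier G" "smooth_at vec_mfd M 0 a"
  using assms by (auto simp: curve_def)

lemma velocity_apply:
  "smooth_fun_near M \<one> f \<Longrightarrow> velocity M \<one> a f = deriv (\<lambda>t. f (a t)) 0"
  by (simp add: velocity_def)

lemma velocity_tangent: "curve a \<Longrightarrow> velocity M \<one> a \<in> \<TT>"
  unfolding tangent_space_def smooth_curve_at_iff curve_def by blast

text \<open>A representing curve is made constant outside a neighbourhood of 0; its germ and hence its velocity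
  do not change.\<close>

lemma tangent_curve:
  assumes "u \<in> \<TT>"
  obtains a where "curve a" "u = velocity M \<one> a"
proof -
  obtain b where b: "u = velocity M \<one> b" "b 0 = \<one>" "smooth_at vec_mfd M 0 b"
    using assms by (auto simp: tangent_space_def smooth_curve_at_iff)
  obtain J where J: "openin (mtop vec_mfd) J" "0 \<in> J" "\<And>t. t \<in> J \<Longrightarrow> b t \<in> topspace (mtop M)"
    by (rule smooth_at_neighbourhood[OF b(3)]) (rule that)
  define a where "a = (\<lambda>t. if t \<in> J then b t else \<one>)"
  have "smooth_at vec_mfd M 0 a"
    by (rule smooth_at_cong[OF charted_euclidean charted_M b(3) J(1,2)]) (simp add: a_def)
  then have "curve a" using J b(2) by (simp add: curve_def a_def topspace_M)
  moreover have *: "deriv (\<lambda>t. f (b t)) 0 = deriv (\<lambda>t. f (a t)) 0" for f :: "'a \<Rightarrow> real"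
    by (rule deriv_cong_ev[OF _ refl])
      (use J in \<open>auto simp: eventually_nhds vec_mfd_def a_def\<close>)
  have "u = velocity M \<one> a"
  proof
    fix f show "u f = velocity M \<one> a f" unfolding b(1) velocity_def *[of f] ..
  qed
  ultimately show ?thesis by (rule that)
qed

lemma smooth_at_curve_compose:
  fixes l :: "'v::euclidean_space \<Rightarrow> real"
  assumes "curve a" "bounded_linear l"
  shows "smooth_at vec_mfd M 0 (\<lambda>x. a (l x))"
  by (rule smooth_at_euclidean_compose[OF smooth_at_bounded_linear[OF assms(2)] _ charted_M])
    (simp add: curveD(3)[OF assms(1)] linear_0[OF bounded_linear.linear[OF assms(2)]])

lemma smooth_at_fun_compose:
  assumes "smooth_fun_near M \<one> f" "smooth_at X M p F" "F p = \<one>" "charted X"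
  shows "smooth_at X vec_mfd p (\<lambda>x. f (F x))"
  by (rule smooth_at_compose[OF assms(4) charted_M charted_euclidean assms(2)])
    (use assms in \<open>simp add: smooth_fun_near_iff\<close>)

lemma smooth_product_of_curves:
  assumes "curve a" "curve b"
  shows "smooth_at vec_mfd M (0, 0) (\<lambda>(s, t). a s \<otimes> b t)"
  using smooth_at_mult[OF charted_euclidean smooth_at_curve_compose[OF assms(1) bounded_linear_fst]
      smooth_at_curve_compose[OF assms(2) bounded_linear_snd]]
  by (simp add: case_prod_beta' zero_prod_def)

lemma smooth_fun_product_of_curves:
  assumes "curve a" "curve b" "smooth_fun_near M \<one> f"
  shows "smooth_at vec_mfd vec_mfd (0, 0) (\<lambda>(s, t). f (a s \<otimes> b t))"
proof -
  have "(case (0, 0) of (s, t) \<Rightarrow> a s \<otimes> b t) = \<one>"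
    by (simp add: curveD[OF assms(1)] curveD[OF assms(2)])
  from smooth_at_fun_compose[OF assms(3) smooth_product_of_curves[OF assms(1,2)] this charted_euclidean]
  show ?thesis by (simp add: case_prod_beta')
qed

lemma smooth_fun_near_neighbourhood:
  assumes "smooth_fun_near M q f"
  obtains W where "openin (mtop M) W" "q \<in> W" "\<And>r. r \<in> W \<Longrightarrow> smooth_fun_near M r f" "W \<subseteq> carrier G"
proof -
  obtain W where W: "openin (mtop M) W" "q \<in> W" "\<And>r. r \<in> W \<Longrightarrow> smooth_at M vec_mfd r f"
    by (rule smooth_at_neighbourhood[OF assms[unfolded smooth_fun_near_iff]]) (rule that)
  then show ?thesis
    using openin_subset[OF W(1)] that[of W] unfolding smooth_fun_near_iff topspace_M by blast
qed

lemma field_of_velocity: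
  assumes b: "curve b" and q: "q \<in> carrier G" "smooth_fun_near M q f"
  shows "\<LL> (velocity M \<one> b) q f = deriv (\<lambda>t. f (q \<otimes> b t)) 0"
  unfolding field_of_eq[OF q]
  by (rule velocity_apply[OF smooth_fun_near_translate]) (use q in simp_all)

text \<open>Near the identity, \<open>\<LL> v q f\<close> is the derivative of \<open>f (q \<otimes> b t)\<close> at \<open>t = 0\<close> for a curve \<open>b\<close> with
  velocity \<open>v\<close>. Read in a chart this is a partial derivative of a smooth function of \<open>(q, t)\<close>.\<close>

lemma smooth_fun_near_field_of:
  assumes v: "v \<in> \<TT>" and f: "smooth_fun_near M \<one> f"
  shows "smooth_fun_near M \<one> (\<lambda>q. \<LL> v q f)"
proof -
  obtain b where b: "curve b" "v = velocity M \<one> b" using tangent_curve[OF v] .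
  obtain U c where c: "(U, c) \<in> atlas M" "\<one> \<in> U" using chart_at[OF charted_M one_topspace] .
  note fE = charted_finite_dim[OF charted_M]
  note chE = charted_vec[OF fE]
  note chE2 = charted_vec[OF finite_dim_prod[OF fE finite_dim_euclidean]]
  note inj = chart_inj_on[OF charted_M c(1)]
  have "smooth_at vec_mfd M (c \<one>, 0::real) (\<lambda>z. inv_into U c (fst z))"
    by (rule smooth_at_compose[OF chE2 chE charted_M smooth_at_bounded_linear[OF bounded_linear_fst]])
      (simp add: smooth_at_inv_chart[OF manifold_M c])
  moreover have "smooth_at vec_mfd M (c \<one>, 0::real) (\<lambda>z. b (snd z))"
    by (rule smooth_at_compose[OF chE2 charted_euclidean charted_M smooth_at_bounded_linear[OF bounded_linear_snd]])
      (simp add: curveD(3)[OF b(1)])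
  ultimately have "smooth_at vec_mfd M (c \<one>, 0::real) (\<lambda>z. inv_into U c (fst z) \<otimes> b (snd z))"
    by (rule smooth_at_mult[OF chE2])
  then have "smooth_at vec_mfd vec_mfd (c \<one>, 0::real) (\<lambda>z. f (inv_into U c (fst z) \<otimes> b (snd z)))"
    by (rule smooth_at_fun_compose[OF f _ _ chE2]) (simp add: inj c(2) curveD[OF b(1)])
  from smooth_at_deriv_second[OF fE this]
  have "smooth_at vec_mfd vec_mfd (c \<one>) (\<lambda>y. deriv (\<lambda>t. f (inv_into U c y \<otimes> b t)) 0)" by simp
  then have sm: "smooth_at M vec_mfd \<one> (\<lambda>q. deriv (\<lambda>t. f (inv_into U c (c q) \<otimes> b t)) 0)"
    by (rule smooth_at_compose[OF charted_M chE charted_euclidean smooth_at_chart[OF manifold_M c]])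
  obtain W where W: "openin (mtop M) W" "\<one> \<in> W" "\<And>r. r \<in> W \<Longrightarrow> smooth_fun_near M r f" "W \<subseteq> carrier G"
    by (rule smooth_fun_near_neighbourhood[OF f]) (rule that)
  have "openin (mtop M) (W \<inter> U)" by (rule openin_Int[OF W(1) chart_openin[OF charted_M c(1)]])
  from smooth_at_cong[OF charted_M charted_euclidean sm this, of "\<lambda>q. \<LL> v q f"] show ?thesis
    unfolding smooth_fun_near_iff b(2)
    using W c(2) inj field_of_velocity[OF b(1)] by (simp add: subset_iff)
qed

text \<open>The key to all computations with the bracket: applying \<open>u\<close> to the function obtained from the
  left-invariant field of \<open>v\<close> is a mixed derivative along a product of curves.\<close>

lemma tangent_field_of_eq_mixed_deriv:
  assumes a: "curve a" and b: "curve b" and f: "smooth_fun_near M \<one> f"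
  shows "velocity M \<one> a (\<lambda>q. \<LL> (velocity M \<one> b) q f) = mixed_deriv (\<lambda>s t. f (a s \<otimes> b t))"
proof -
  obtain W where W: "openin (mtop M) W" "\<one> \<in> W" "\<And>r. r \<in> W \<Longrightarrow> smooth_fun_near M r f" "W \<subseteq> carrier G"
    by (rule smooth_fun_near_neighbourhood[OF f]) (rule that)
  have "a 0 \<in> W" using W(2) curveD(1)[OF a] by simp
  then obtain J where J: "openin (mtop vec_mfd) J" "0 \<in> J" "\<And>t. t \<in> J \<Longrightarrow> a t \<in> W"
    by (rule smooth_at_preimage[OF curveD(3)[OF a] W(1)]) (rule that)
  have "\<forall>\<^sub>F s in nhds 0. \<LL> (velocity M \<one> b) (a s) f = deriv (\<lambda>t. f (a s \<otimes> b t)) 0"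
    unfolding eventually_nhds using J W field_of_velocity[OF b curveD(2)[OF a]]
    by (intro exI[of _ J]) (auto simp: vec_mfd_def)
  then show ?thesis
    unfolding mixed_deriv_def velocity_apply[OF smooth_fun_near_field_of[OF velocity_tangent[OF b] f]]
    by (rule deriv_cong_ev[OF _ refl])
qed

definition br :: "'a tangent \<Rightarrow> 'a tangent \<Rightarrow> 'a tangent" where
  "br u v = vf_bracket M (\<LL> u) (\<LL> v) \<one>"

text \<open>Identifies the outer vectors in the commutator of two left-invariant fields at the identity.\<close>

lemma field_of_one: "u \<in> \<TT> \<Longrightarrow> \<LL> u \<one> f = u f"
proof (cases "smooth_fun_near M \<one> f")
  case True
  assume "u \<in> \<TT>"
  then show ?thesis
    unfolding field_of_eq[OF one_closed True]
    by (rule tangent_local[OF manifold_M one_topspace _ openin_topspace one_topspace]) (simp add: topspace_M)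
qed (simp add: left_inv_field_def tangent_map_def tangent_eq_0[OF manifold_M one_topspace])

lemma br_apply:
  assumes "u \<in> \<TT>" "v \<in> \<TT>" "smooth_fun_near M \<one> f"
  shows "br u v f = u (\<lambda>q. \<LL> v q f) - v (\<lambda>q. \<LL> u q f)"
  using assms by (simp add: br_def vf_bracket_def field_of_one)

lemma br_not_smooth: "\<not> smooth_fun_near M \<one> f \<Longrightarrow> br u v f = 0"
  by (simp add: br_def vf_bracket_def)

text \<open>The symmetry of mixed derivatives makes \<open>s\<close> belong to \<open>a\<close> and \<open>t\<close> to \<open>b\<close> in both terms: the
  bracket is the infinitesimal commutator.\<close>

lemma br_velocity:
  assumes a: "curve a" and b: "curve b" and f: "smooth_fun_near M \<one> f"
  shows "br (velocity M \<one> a) (velocity M \<one> b) f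
    = mixed_deriv (\<lambda>s t. f (a s \<otimes> b t)) - mixed_deriv (\<lambda>s t. f (b t \<otimes> a s))"
  using mixed_deriv_swap[OF smooth_fun_product_of_curves[OF b a f]]
  by (simp add: br_apply[OF velocity_tangent[OF a] velocity_tangent[OF b] f]
      tangent_field_of_eq_mixed_deriv[OF _ _ f] a b)

text \<open>In a chart, the products \<open>a s \<otimes> b t\<close> and \<open>b t \<otimes> a s\<close> agree on both axes because the curves pass
  through the identity. Hence the difference of their mixed derivatives is a first-order operator, that is,
  a tangent vector.\<close>

lemma br_closed:
  assumes u: "u \<in> \<TT>" and v: "v \<in> \<TT>"
  shows "br u v \<in> \<TT>"
proof -
  obtain a where a: "curve a" "u = velocity M \<one> a" using tangent_curve[OF u] .
  obtain b where b: "curve b" "v = velocity M \<one> b" using tangent_curve[OF v] .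
  obtain U c where c: "(U, c) \<in> atlas M" "\<one> \<in> U" using chart_at[OF charted_M one_topspace] .
  note fE = charted_finite_dim[OF charted_M]
  note chE = charted_vec[OF fE]
  note inj = chart_inj_on[OF charted_M c(1)]
  define P where "P = (\<lambda>(s, t). c (a s \<otimes> b t))"
  define Q where "Q = (\<lambda>(s, t). c (b t \<otimes> a s))"
  have ab: "smooth_at vec_mfd M (0, 0) (\<lambda>(s, t). a s \<otimes> b t)"
    by (rule smooth_product_of_curves[OF a(1) b(1)])
  have ba: "smooth_at vec_mfd M (0, 0) (\<lambda>(s, t). b t \<otimes> a s)"
    using smooth_at_mult[OF charted_euclidean smooth_at_curve_compose[OF b(1) bounded_linear_snd]
      smooth_at_curve_compose[OF a(1) bounded_linear_fst]]
    by (simp add: case_prod_beta' zero_prod_def)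
  have P: "smooth_at vec_mfd vec_mfd (0, 0) P"
    using smooth_at_compose[OF charted_euclidean charted_M chE ab, of c] smooth_at_chart[OF manifold_M c]
    by (simp add: P_def case_prod_beta' curveD[OF a(1)] curveD[OF b(1)])
  have Q: "smooth_at vec_mfd vec_mfd (0, 0) Q"
    using smooth_at_compose[OF charted_euclidean charted_M chE ba, of c] smooth_at_chart[OF manifold_M c]
    by (simp add: Q_def case_prod_beta' curveD[OF a(1)] curveD[OF b(1)])
  have P0: "P (0, 0) = c \<one>" by (simp add: P_def curveD[OF a(1)] curveD[OF b(1)])
  have axes: "P (s, 0) = Q (s, 0)" "P (0, t) = Q (0, t)" for s t
    by (simp_all add: P_def Q_def curveD[OF a(1)] curveD[OF b(1)])
  obtain w where w: "\<And>F :: 'e \<Rightarrow> real. smooth_at vec_mfd vec_mfd (P (0, 0)) F \<Longrightarrow>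
      mixed_deriv (\<lambda>s t. F (P (s, t))) - mixed_deriv (\<lambda>s t. F (Q (s, t)))
        = frechet_derivative F (at (P (0, 0))) w"
    by (rule mixed_deriv_diff_eq_frechet[OF fE P Q axes]) (rule that)
  obtain J where J: "openin (mtop vec_mfd) J" "(0, 0) \<in> J" "\<And>z. z \<in> J \<Longrightarrow> (case z of (s, t) \<Rightarrow> a s \<otimes> b t) \<in> U"
    by (rule smooth_at_preimage[OF ab chart_openin[OF charted_M c(1)]])
      (simp add: c(2) curveD[OF a(1)] curveD[OF b(1)], rule that)
  obtain J' where J': "openin (mtop vec_mfd) J'" "(0, 0) \<in> J'" "\<And>z. z \<in> J' \<Longrightarrow> (case z of (s, t) \<Rightarrow> b t \<otimes> a s) \<in> U"
    by (rule smooth_at_preimage[OF ba chart_openin[OF charted_M c(1)]])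
      (simp add: c(2) curveD[OF a(1)] curveD[OF b(1)], rule that)
  have "br u v f = chart_tangent M \<one> U c w f" for f
  proof (cases "smooth_fun_near M \<one> f")
    case True
    define F where "F = f \<circ> inv_into U c"
    have F: "smooth_at vec_mfd vec_mfd (P (0, 0)) F"
      unfolding P0 F_def using True
      by (intro smooth_at_fun_in_chart[OF manifold_M c]) (simp add: smooth_fun_near_iff)
    have "mixed_deriv (\<lambda>s t. F (P (s, t))) = mixed_deriv (\<lambda>s t. f (a s \<otimes> b t))"
      by (rule mixed_deriv_cong[of J]) (use J inj in \<open>auto simp: vec_mfd_def F_def P_def\<close>)
    moreover have "mixed_deriv (\<lambda>s t. F (Q (s, t))) = mixed_deriv (\<lambda>s t. f (b t \<otimes> a s))"
      by (rule mixed_deriv_cong[of J']) (use J' inj in \<open>auto simp: vec_mfd_def F_def Q_def\<close>)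
    ultimately show ?thesis
      using w[OF F] True br_velocity[OF a(1) b(1) True]
      by (simp add: a(2) b(2) chart_tangent_def P0 F_def)
  qed (simp add: br_not_smooth chart_tangent_def)
  then have "br u v = chart_tangent M \<one> U c w" ..
  then show ?thesis unfolding tangent_space_eq_range_chart_tangent[OF manifold_M c] by blast
qed

section \<open>The Lie algebra axioms\<close>

text \<open>Left translation intertwines left-invariant fields, by associativity.\<close>

lemma field_of_translate:
  assumes w: "w \<in> \<TT>" and q: "q \<in> carrier G" "r \<in> carrier G" and f: "smooth_fun_near M (q \<otimes> r) f"
  shows "\<LL> w r (\<lambda>x. f (q \<otimes> x)) = \<LL> w (q \<otimes> r) f"
proof -
  have "\<LL> w r (\<lambda>x. f (q \<otimes> x)) = w (\<lambda>x. f (q \<otimes> (r \<otimes> x)))"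
    by (rule field_of_eq[OF q(2) smooth_fun_near_translate[OF q f]])
  also have "\<dots> = w (\<lambda>x. f (q \<otimes> r \<otimes> x))"
    by (rule tangent_local[OF manifold_M one_topspace w openin_topspace one_topspace])
      (use q in \<open>simp add: topspace_M m_assoc\<close>)
  also have "\<dots> = \<LL> w (q \<otimes> r) f"
    by (rule field_of_eq[symmetric]) (use q f in simp_all)
  finally show ?thesis .
qed

text \<open>The bracket of left-invariant fields is left-invariant: near the identity, the left-invariant
  field of \<open>br v w\<close> is the commutator of those of \<open>v\<close> and \<open>w\<close>. On translates \<open>f \<circ> L\<^sub>q\<close> the formula for the
  bracket at the identity becomes the one at \<open>q\<close>.\<close>

lemma field_of_br:
  assumes v: "v \<in> \<TT>" and w: "w \<in> \<TT>" and f: "smooth_fun_near M \<one> f"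
  obtains W where "openin (mtop M) W" "\<one> \<in> W"
    "\<And>q. q \<in> W \<Longrightarrow> \<LL> (br v w) q f = \<LL> v q (\<lambda>r. \<LL> w r f) - \<LL> w q (\<lambda>r. \<LL> v r f)"
proof -
  obtain W0 where W0: "openin (mtop M) W0" "\<one> \<in> W0" "\<And>r. r \<in> W0 \<Longrightarrow> smooth_fun_near M r f" "W0 \<subseteq> carrier G"
    by (rule smooth_fun_near_neighbourhood[OF f]) (rule that)
  obtain W1 where W1: "openin (mtop M) W1" "\<one> \<in> W1"
    "\<And>r. r \<in> W1 \<Longrightarrow> smooth_fun_near M r (\<lambda>r. \<LL> v r f)" "W1 \<subseteq> carrier G"
    by (rule smooth_fun_near_neighbourhood[OF smooth_fun_near_field_of[OF v f]]) (rule that)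
  obtain W2 where W2: "openin (mtop M) W2" "\<one> \<in> W2"
    "\<And>r. r \<in> W2 \<Longrightarrow> smooth_fun_near M r (\<lambda>r. \<LL> w r f)" "W2 \<subseteq> carrier G"
    by (rule smooth_fun_near_neighbourhood[OF smooth_fun_near_field_of[OF w f]]) (rule that)
  show ?thesis
  proof (rule that)
    show "openin (mtop M) (W0 \<inter> (W1 \<inter> W2))"
      by (rule openin_Int[OF W0(1) openin_Int[OF W1(1) W2(1)]])
    show "\<one> \<in> W0 \<inter> (W1 \<inter> W2)" using W0 W1 W2 by simp
    fix q assume q: "q \<in> W0 \<inter> (W1 \<inter> W2)"
    then have qG: "q \<in> carrier G" using W0(4) by blast
    have near: "smooth_fun_near M q f" "smooth_fun_near M q (\<lambda>r. \<LL> v r f)" "smooth_fun_near M q (\<lambda>r. \<LL> w r f)"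
      using q W0 W1 W2 by simp_all
    have fq: "smooth_fun_near M \<one> (\<lambda>x. f (q \<otimes> x))"
      by (rule smooth_fun_near_translate) (use qG near in simp_all)
    have "q \<otimes> \<one> \<in> W0" using q qG by simp
    then obtain V where V: "openin (mtop M) V" "\<one> \<in> V" "\<And>r. r \<in> V \<Longrightarrow> q \<otimes> r \<in> W0"
      by (rule smooth_at_preimage[OF smooth_at_left_translation[OF qG one_closed] W0(1)]) (rule that)
    have VG: "V \<subseteq> carrier G" using openin_subset[OF V(1)] by (simp add: topspace_M)
    have tr: "x (\<lambda>r. \<LL> y r (\<lambda>x. f (q \<otimes> x))) = \<LL> x q (\<lambda>r. \<LL> y r f)"
      if x: "x \<in> \<TT>" and y: "y \<in> \<TT>" and sm: "smooth_fun_near M q (\<lambda>r. \<LL> y r f)" for x y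
    proof -
      have "x (\<lambda>r. \<LL> y r (\<lambda>x. f (q \<otimes> x))) = x (\<lambda>r. \<LL> y (q \<otimes> r) f)"
        by (rule tangent_local[OF manifold_M one_topspace x V(1,2)], rule field_of_translate[OF y qG])
          (use VG V(3) W0(3) in auto)
      also have "\<dots> = \<LL> x q (\<lambda>r. \<LL> y r f)"
        by (rule field_of_eq[OF qG sm, symmetric])
      finally show ?thesis .
    qed
    have "\<LL> (br v w) q f = br v w (\<lambda>x. f (q \<otimes> x))" by (rule field_of_eq[OF qG near(1)])
    also have "\<dots> = v (\<lambda>r. \<LL> w r (\<lambda>x. f (q \<otimes> x))) - w (\<lambda>r. \<LL> v r (\<lambda>x. f (q \<otimes> x)))"
      by (rule br_apply[OF v w fq])
    also have "\<dots> = \<LL> v q (\<lambda>r. \<LL> w r f) - \<LL> w q (\<lambda>r. \<LL> v r f)"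
      by (simp only: tr[OF v w near(3)] tr[OF w v near(2)])
    finally show "\<LL> (br v w) q f = \<LL> v q (\<lambda>r. \<LL> w r f) - \<LL> w q (\<lambda>r. \<LL> v r f)" .
  qed
qed

lemma tangent_field_of_br:
  assumes u: "u \<in> \<TT>" and v: "v \<in> \<TT>" and w: "w \<in> \<TT>" and f: "smooth_fun_near M \<one> f"
  shows "u (\<lambda>q. \<LL> (br v w) q f)
    = u (\<lambda>q. \<LL> v q (\<lambda>r. \<LL> w r f)) - u (\<lambda>q. \<LL> w q (\<lambda>r. \<LL> v r f))"
proof -
  obtain W where W: "openin (mtop M) W" "\<one> \<in> W"
    "\<And>q. q \<in> W \<Longrightarrow> \<LL> (br v w) q f = \<LL> v q (\<lambda>r. \<LL> w r f) - \<LL> w q (\<lambda>r. \<LL> v r f)"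
    by (rule field_of_br[OF v w f]) (rule that)
  have "u (\<lambda>q. \<LL> (br v w) q f) = u (\<lambda>q. \<LL> v q (\<lambda>r. \<LL> w r f) - \<LL> w q (\<lambda>r. \<LL> v r f))"
    by (rule tangent_local[OF manifold_M one_topspace u W])
  also have "\<dots> = u (\<lambda>q. \<LL> v q (\<lambda>r. \<LL> w r f)) - u (\<lambda>q. \<LL> w q (\<lambda>r. \<LL> v r f))"
    by (rule tangent_diff[OF manifold_M one_topspace u]; rule smooth_fun_near_field_of;
        (rule v w | rule smooth_fun_near_field_of[OF _ f], rule v w))
  finally show ?thesis .
qed

text \<open>Iterated brackets are expressed through threefold applications of left-invariant fields, so that
  the Jacobi identity becomes a cancellation of twelve terms.\<close>

lemma br_br_apply:
  assumes u: "u \<in> \<TT>" and v: "v \<in> \<TT>" and w: "w \<in> \<TT>" and f: "smooth_fun_near M \<one> f"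
  shows "br u (br v w) f
    = u (\<lambda>q. \<LL> v q (\<lambda>r. \<LL> w r f)) - u (\<lambda>q. \<LL> w q (\<lambda>r. \<LL> v r f))
    - v (\<lambda>q. \<LL> w q (\<lambda>r. \<LL> u r f)) + w (\<lambda>q. \<LL> v q (\<lambda>r. \<LL> u r f))"
  by (simp add: br_apply[OF u br_closed[OF v w] f] tangent_field_of_br[OF u v w f]
      br_apply[OF v w smooth_fun_near_field_of[OF u f]])

lemma jacobi:
  assumes "u \<in> \<TT>" "v \<in> \<TT>" "w \<in> \<TT>"
  shows "br u (br v w) f + br v (br w u) f + br w (br u v) f = 0"
  by (cases "smooth_fun_near M \<one> f") (use assms in \<open>simp_all add: br_br_apply br_not_smooth\<close>)

lemma field_of_linear: "\<LL> (\<lambda>f. a * u f + b * v f) q f = a * \<LL> u q f + b * \<LL> v q f"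
  by (simp add: left_inv_field_def tangent_map_def)

lemma br_self: "br u u = (\<lambda>f. 0)"
  by (simp add: br_def vf_bracket_def fun_eq_iff)

lemma br_anticommute: "br u v f = - br v u f"
  by (simp add: br_def vf_bracket_def)

lemma tangent_space_linear:
  "u \<in> \<TT> \<Longrightarrow> v \<in> \<TT> \<Longrightarrow> (\<lambda>f. a * u f + b * v f) \<in> \<TT>"
  by (intro tangent_space_add[OF manifold_M one_topspace] tangent_space_scale[OF manifold_M one_topspace])

lemma br_linear_right:
  assumes u: "u \<in> \<TT>" and v: "v \<in> \<TT>" and w: "w \<in> \<TT>"
  shows "br u (\<lambda>f. a * v f + b * w f) = (\<lambda>f. a * br u v f + b * br u w f)"
proof
  fix f
  show "br u (\<lambda>f. a * v f + b * w f) f = a * br u v f + b * br u w f"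
  proof (cases "smooth_fun_near M \<one> f")
    case True
    note sm = smooth_fun_near_field_of[OF v True] smooth_fun_near_field_of[OF w True]
    have "br u (\<lambda>f. a * v f + b * w f) f
      = a * u (\<lambda>q. \<LL> v q f) + b * u (\<lambda>q. \<LL> w q f)
      - (a * v (\<lambda>q. \<LL> u q f) + b * w (\<lambda>q. \<LL> u q f))"
      by (simp only: br_apply[OF u tangent_space_linear[OF v w] True] field_of_linear
          tangent_linear[OF manifold_M one_topspace u sm])
    then show ?thesis
      by (simp add: br_apply[OF u v True] br_apply[OF u w True] algebra_simps)
  qed (simp add: br_not_smooth)
qed

lemma br_linear_left:
  assumes u: "u \<in> \<TT>" and v: "v \<in> \<TT>" and w: "w \<in> \<TT>"
  shows "br (\<lambda>f. a * v f + b * w f) u = (\<lambda>f. a * br v u f + b * br w u f)"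
proof
  fix f
  have "br (\<lambda>f. a * v f + b * w f) u f = - br u (\<lambda>f. a * v f + b * w f) f"
    by (rule br_anticommute)
  also have "\<dots> = a * - br u v f + b * - br u w f" by (simp add: br_linear_right[OF u v w])
  also have "\<dots> = a * br v u f + b * br w u f" by (simp only: br_anticommute[symmetric])
  finally show "br (\<lambda>f. a * v f + b * w f) u f = a * br v u f + b * br w u f" .
qed

lemma real_ring_field: "Ring.field real_ring"
proof (rule cring.cring_fieldI2)
  show "cring real_ring"
  proof (rule cringI)
    show "abelian_group real_ring"
    proof (rule abelian_groupI)
      show "\<exists>y\<in>carrier real_ring. y \<oplus>\<^bsub>real_ring\<^esub> x = \<zero>\<^bsub>real_ring\<^esub>" for x
        by (rule bexI[of _ "- x"]) (simp_all add: real_ring_def)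
    qed (simp_all add: real_ring_def)
    show "Group.comm_monoid real_ring"
      by (rule comm_monoidI) (simp_all add: real_ring_def)
  qed (simp add: real_ring_def algebra_simps)
  show "\<zero>\<^bsub>real_ring\<^esub> \<noteq> \<one>\<^bsub>real_ring\<^esub>" by (simp add: real_ring_def)
  show "\<exists>b\<in>carrier real_ring. a \<otimes>\<^bsub>real_ring\<^esub> b = \<one>\<^bsub>real_ring\<^esub>"
    if "a \<in> carrier real_ring" "a \<noteq> \<zero>\<^bsub>real_ring\<^esub>" for a
    using that by (intro bexI[of _ "1 / a"]) (simp_all add: real_ring_def)
qed

abbreviation lie_alg_of_group ("\<gg>") where "\<gg> \<equiv> lie_algebra_of G M"

lemma lie_algebra_of_simps:
  "carrier \<gg> = \<TT>" "zero \<gg> = (\<lambda>f. 0)" "add \<gg> = (\<lambda>u v f. u f + v f)"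
  "smult \<gg> = (\<lambda>r u f. r * u f)" "lie_br \<gg> = br"
  by (simp_all add: lie_algebra_of_def br_def fun_eq_iff)

lemma module_lie_algebra_of: "Module.module real_ring \<gg>"
proof (rule moduleI)
  show "cring real_ring" using real_ring_field by (simp add: field_def domain_def)
  show "abelian_group \<gg>"
  proof (rule abelian_groupI)
    show "\<exists>y\<in>carrier \<gg>. y \<oplus>\<^bsub>\<gg>\<^esub> u = \<zero>\<^bsub>\<gg>\<^esub>" if "u \<in> carrier \<gg>" for u
      using that tangent_space_scale[OF manifold_M one_topspace, of u "-1"]
      by (intro bexI[of _ "\<lambda>f. - 1 * u f"]) (simp_all add: lie_algebra_of_simps)
  qed (simp_all add: lie_algebra_of_simps tangent_space_add[OF manifold_M one_topspace]
      tangent_space_0[OF manifold_M one_topspace] fun_eq_iff)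
qed (simp_all add: lie_algebra_of_simps tangent_space_scale[OF manifold_M one_topspace] real_ring_def
    fun_eq_iff algebra_simps)

lemma lie_algebra_lie_algebra_of: "lie_algebra real_ring \<gg>"
proof -
  have bilinear: "br (\<lambda>f. u f + v f) w = (\<lambda>f. br u w f + br v w f)"
    "br w (\<lambda>f. u f + v f) = (\<lambda>f. br w u f + br w v f)"
    "br (\<lambda>f. r * u f) w = (\<lambda>f. r * br u w f)"
    "br w (\<lambda>f. r * u f) = (\<lambda>f. r * br w u f)"
    if "u \<in> \<TT>" "v \<in> \<TT>" "w \<in> \<TT>" for u v w r
    using br_linear_left[OF that(3,1,2), of 1 1] br_linear_right[OF that(3,1,2), of 1 1]
      br_linear_left[OF that(3,1,2), of r 0] br_linear_right[OF that(3,1,2), of r 0]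
    by simp_all
  have "(\<lambda>f. br u (br v w) f + br v (br w u) f + br w (br u v) f) = (\<lambda>f. 0)"
    if "u \<in> \<TT>" "v \<in> \<TT>" "w \<in> \<TT>" for u v w
    using jacobi[OF that] by (simp add: fun_eq_iff)
  then show ?thesis
    unfolding lie_algebra_def lie_algebra_of_simps
    using real_ring_field module_lie_algebra_of bilinear br_closed br_self
    by (intro conjI ballI) simp_all
qed

section \<open>Tangent maps and the Rota-Baxter identity\<close>

lemma tangent_map_velocity:
  assumes F: "smooth_at M M \<one> F" "F \<one> = \<one>"
  shows "tangent_map M \<one> F (velocity M \<one> a) = velocity M \<one> (\<lambda>t. F (a t))"
proof
  fix f
  have "smooth_fun_near M \<one> (f \<circ> F)" if "smooth_fun_near M \<one> f"
    using smooth_at_fun_compose[OF that F charted_M] by (simp add: smooth_fun_near_iff comp_def)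
  then show "tangent_map M \<one> F (velocity M \<one> a) f = velocity M \<one> (\<lambda>t. F (a t)) f"
    by (simp add: tangent_map_def F(2) velocity_def comp_def)
qed

lemma curve_image:
  assumes "smooth_at M M \<one> F" "F \<one> = \<one>" "F \<in> carrier G \<rightarrow> carrier G" "curve a"
  shows "curve (\<lambda>t. F (a t))"
  using assms smooth_at_compose[OF charted_euclidean charted_M charted_M curveD(3)[OF assms(4)], of F]
  by (auto simp: curve_def)

lemma linear_operator_tangent_map:
  assumes F: "smooth_at M M \<one> F" "F \<one> = \<one>" "F \<in> carrier G \<rightarrow> carrier G"
  shows "linear_operator real_ring \<gg> (tangent_map M \<one> F)"
proof -
  have "tangent_map M \<one> F u \<in> \<TT>" if u: "u \<in> \<TT>" for u
  proof -
    obtain a where a: "curve a" "u = velocity M \<one> a" using tangent_curve[OF u] .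
    show ?thesis
      unfolding a(2) tangent_map_velocity[OF F(1,2)] by (rule velocity_tangent[OF curve_image[OF F a(1)]])
  qed
  then show ?thesis
    unfolding linear_operator_def lie_algebra_of_simps
    by (auto simp: tangent_map_def fun_eq_iff)
qed

text \<open>The variable \<open>s\<close> occurs in three places, so the mixed derivative is a sum of three terms, in each of
  which the other two occurrences are set to the identity. The third term is that of \<open>z t \<otimes> inv (y s)\<close>;
  it is the negative of that of \<open>z t \<otimes> y s\<close>, because \<open>z t \<otimes> y s \<otimes> inv (y s)\<close> does not depend on \<open>s\<close>.\<close>

lemma mixed_deriv_conjugation:
  assumes x: "curve x" and y: "curve y" and z: "curve z" and h: "smooth_fun_near M \<one> h"
  shows "mixed_deriv (\<lambda>s t. h (x s \<otimes> y s \<otimes> z t \<otimes> inv (y s))) =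
    mixed_deriv (\<lambda>s t. h (x s \<otimes> z t)) + mixed_deriv (\<lambda>s t. h (y s \<otimes> z t))
    - mixed_deriv (\<lambda>s t. h (z t \<otimes> y s))"
proof -
  note c = curveD(1,2)[OF x] curveD(1,2)[OF y] curveD(1,2)[OF z]
  have bl: "bounded_linear (\<lambda>w::(real \<times> real) \<times> real. fst (fst w))"
    "bounded_linear (\<lambda>w::(real \<times> real) \<times> real. snd (fst w))"
    by (intro bounded_linear_compose[OF bounded_linear_fst bounded_linear_fst]
        bounded_linear_compose[OF bounded_linear_snd bounded_linear_fst])+
  note 1 = smooth_at_curve_compose[OF _ bl(1)] and 2 = smooth_at_curve_compose[OF _ bl(2)]
    and 3 = smooth_at_curve_compose[OF z bounded_linear_snd]
  note m = smooth_at_mult[OF charted_euclidean] and i = smooth_at_inverse[OF charted_euclidean]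
  have A: "mixed_deriv (\<lambda>s t. h (x s \<otimes> y s \<otimes> z t \<otimes> inv (y s))) =
    mixed_deriv (\<lambda>s t. h (x s \<otimes> y 0 \<otimes> z t \<otimes> inv (y 0))) +
    mixed_deriv (\<lambda>s t. h (x 0 \<otimes> y s \<otimes> z t \<otimes> inv (y s)))"
    using smooth_at_fun_compose[OF h m[OF m[OF m[OF 1[OF x] 2[OF y]] 3] i[OF 2[OF y]]] _ charted_euclidean]
    by (intro mixed_deriv_diagonal) (simp add: c case_prod_beta' zero_prod_def)
  have B: "mixed_deriv (\<lambda>s t. h (y s \<otimes> z t \<otimes> inv (y s))) =
    mixed_deriv (\<lambda>s t. h (y s \<otimes> z t \<otimes> inv (y 0))) +
    mixed_deriv (\<lambda>s t. h (y 0 \<otimes> z t \<otimes> inv (y s)))"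
    using smooth_at_fun_compose[OF h m[OF m[OF 1[OF y] 3] i[OF 2[OF y]]] _ charted_euclidean]
    by (intro mixed_deriv_diagonal) (simp add: c case_prod_beta' zero_prod_def)
  have C: "mixed_deriv (\<lambda>s t. h (z t \<otimes> y s \<otimes> inv (y s))) =
    mixed_deriv (\<lambda>s t. h (z t \<otimes> y s \<otimes> inv (y 0))) +
    mixed_deriv (\<lambda>s t. h (z t \<otimes> y 0 \<otimes> inv (y s)))"
    using smooth_at_fun_compose[OF h m[OF m[OF 3 1[OF y]] i[OF 2[OF y]]] _ charted_euclidean]
    by (intro mixed_deriv_diagonal) (simp add: c case_prod_beta' zero_prod_def)
  have "mixed_deriv (\<lambda>s t. h (z t \<otimes> y s \<otimes> inv (y s))) = 0"
    by (simp add: c m_assoc mixed_deriv_def)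
  then show ?thesis using A B C by (simp add: c)
qed

text \<open>For curves \<open>a\<close> and \<open>b\<close> with velocities \<open>u\<close> and \<open>v\<close>, the left-hand side is the difference of the
  mixed derivatives of \<open>f (\<BB> a \<otimes> \<BB> b)\<close> and \<open>f (\<BB> b \<otimes> \<BB> a)\<close>. The group identity rewrites both as derivatives of
  \<open>h = f \<circ> \<BB> \<circ> \<Psi>\<close> along conjugation products, which split into three terms each. The six terms
  pair up to the three brackets, evaluated at \<open>h\<close>.\<close>

lemma rota_baxter_identity:
  assumes F: "smooth_at M M \<one> \<Phi>" "\<Phi> \<one> = \<one>" "\<Phi> \<in> carrier G \<rightarrow> carrier G"
    and P: "smooth_at M M \<one> \<Psi>" "\<Psi> \<one> = \<one>"
    and B: "smooth_at M M \<one> \<BB>" "\<BB> \<one> = \<one>" "\<BB> \<in> carrier G \<rightarrow> carrier G"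
    and rb: "\<And>a b. a \<in> carrier G \<Longrightarrow> b \<in> carrier G \<Longrightarrow>
      \<BB> a \<otimes> \<BB> b = \<BB> (\<Psi> (\<Phi> a \<otimes> \<BB> a \<otimes> \<Phi> b \<otimes> inv (\<BB> a)))"
    and u: "u \<in> \<TT>" and v: "v \<in> \<TT>"
  defines "\<phi> \<equiv> tangent_map M \<one> \<Phi>" and "\<psi> \<equiv> tangent_map M \<one> \<Psi>" and "\<beta> \<equiv> tangent_map M \<one> \<BB>"
  shows "br (\<beta> u) (\<beta> v) = \<beta> (\<psi> (\<lambda>f. br (\<beta> u) (\<phi> v) f + br (\<phi> u) (\<beta> v) f + br (\<phi> u) (\<phi> v) f))"
proof
  fix f
  show "br (\<beta> u) (\<beta> v) f = \<beta> (\<psi> (\<lambda>f. br (\<beta> u) (\<phi> v) f + br (\<phi> u) (\<beta> v) f + br (\<phi> u) (\<phi> v) f)) f"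
  proof (cases "smooth_fun_near M \<one> f")
    case False
    then show ?thesis by (simp add: br_not_smooth \<beta>_def tangent_map_def B(2))
  next
    case f: True
    define g where "g = f \<circ> \<BB>"
    define h where "h = g \<circ> \<Psi>"
    have g: "smooth_fun_near M \<one> g"
      using smooth_at_fun_compose[OF f B(1,2) charted_M] by (simp add: smooth_fun_near_iff g_def comp_def)
    have h: "smooth_fun_near M \<one> h"
      using smooth_at_fun_compose[OF g P charted_M] by (simp add: smooth_fun_near_iff h_def comp_def)
    obtain a where a: "curve a" "u = velocity M \<one> a" using tangent_curve[OF u] .
    obtain b where b: "curve b" "v = velocity M \<one> b" using tangent_curve[OF v] .
    define x where "x = (\<lambda>t. \<Phi> (a t))"
    define y where "y = (\<lambda>t. \<BB> (a t))"
    define x' where "x' = (\<lambda>t. \<Phi> (b t))"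
    define y' where "y' = (\<lambda>t. \<BB> (b t))"
    have curves: "curve x" "curve y" "curve x'" "curve y'"
      unfolding x_def y_def x'_def y'_def
      by (rule curve_image[OF F a(1)] curve_image[OF B a(1)] curve_image[OF F b(1)] curve_image[OF B b(1)])+
    have vel: "\<phi> u = velocity M \<one> x" "\<beta> u = velocity M \<one> y" "\<phi> v = velocity M \<one> x'" "\<beta> v = velocity M \<one> y'"
      unfolding \<phi>_def \<beta>_def x_def y_def x'_def y'_def a(2) b(2)
      by (rule tangent_map_velocity[OF F(1,2)] tangent_map_velocity[OF B(1,2)])+
    have ab: "f (y s \<otimes> y' t) = h (x s \<otimes> y s \<otimes> x' t \<otimes> inv (y s))"
      "f (y' t \<otimes> y s) = h (x' t \<otimes> y' t \<otimes> x s \<otimes> inv (y' t))" for s t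
      by (simp_all add: h_def g_def x_def y_def x'_def y'_def rb curveD(2)[OF a(1)] curveD(2)[OF b(1)])
    have swap: "mixed_deriv (\<lambda>s t. h (c t \<otimes> d s)) = mixed_deriv (\<lambda>s t. h (c s \<otimes> d t))"
      if "curve c" "curve d" for c d
      by (rule mixed_deriv_swap[OF smooth_fun_product_of_curves[OF that h]])
    have "mixed_deriv (\<lambda>s t. f (y' t \<otimes> y s)) = mixed_deriv (\<lambda>s t. f (y' s \<otimes> y t))"
      by (rule mixed_deriv_swap[OF smooth_fun_product_of_curves[OF curves(4,2) f]])
    also have "\<dots> = mixed_deriv (\<lambda>s t. h (x' s \<otimes> y' s \<otimes> x t \<otimes> inv (y' s)))"
      by (simp only: ab(2))
    also have "\<dots> = mixed_deriv (\<lambda>s t. h (x' s \<otimes> x t)) + mixed_deriv (\<lambda>s t. h (y' s \<otimes> x t))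
        - mixed_deriv (\<lambda>s t. h (x t \<otimes> y' s))"
      by (rule mixed_deriv_conjugation[OF curves(3,4,1) h])
    also have "\<dots> = mixed_deriv (\<lambda>s t. h (x' t \<otimes> x s)) + mixed_deriv (\<lambda>s t. h (y' t \<otimes> x s))
        - mixed_deriv (\<lambda>s t. h (x s \<otimes> y' t))"
      by (simp only: swap[OF curves(3,1)] swap[OF curves(4,1)] swap[OF curves(1,4)])
    finally have 2: "mixed_deriv (\<lambda>s t. f (y' t \<otimes> y s)) = \<dots>" .
    have pullback: "\<beta> (\<psi> X) f = X h" for X
      unfolding \<beta>_def \<psi>_def using f g[unfolded g_def]
      by (simp add: tangent_map_def B(2) P(2) g_def h_def)
    have "br (\<beta> u) (\<beta> v) f = br (\<beta> u) (\<phi> v) h + br (\<phi> u) (\<beta> v) h + br (\<phi> u) (\<phi> v) h"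
      unfolding vel br_velocity[OF curves(2,4) f] br_velocity[OF curves(2,3) h]
        br_velocity[OF curves(1,4) h] br_velocity[OF curves(1,3) h] 2
      by (simp add: ab(1) mixed_deriv_conjugation[OF curves(1-3) h])
    also have "\<dots> = \<beta> (\<psi> (\<lambda>f. br (\<beta> u) (\<phi> v) f + br (\<phi> u) (\<beta> v) f + br (\<phi> u) (\<phi> v) f)) f"
      by (rule pullback[symmetric])
    finally show ?thesis .
  qed
qed

lemma tangent_map_right_inverse:
  assumes F: "smooth_at M M \<one> \<Phi>" "\<Phi> \<one> = \<one>" and P: "smooth_at M M \<one> \<Psi>" "\<Psi> \<one> = \<one>"
    and inv: "\<And>x. x \<in> carrier G \<Longrightarrow> \<Phi> (\<Psi> x) = x" and u: "u \<in> \<TT>"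
  shows "tangent_map M \<one> \<Phi> (tangent_map M \<one> \<Psi> u) = u"
proof -
  obtain a where a: "curve a" "u = velocity M \<one> a" using tangent_curve[OF u] .
  show ?thesis
    unfolding a(2) tangent_map_velocity[OF P] tangent_map_velocity[OF F] inv[OF curveD(2)[OF a(1)]] ..
qed

end

theorem theorem2p10:
  fixes G :: "('a, 'm) monoid_scheme"
    and M :: "('a, 'e::real_normed_vector) mfd"
    and \<Phi> \<Psi> \<BB> :: "'a \<Rightarrow> 'a"
  assumes "rota_baxter_lie_group G M \<Phi> \<Psi> \<BB>"
    and "unital_pair G \<Phi> \<Psi>"
  defines "\<phi> \<equiv> tangent_map M \<one>\<^bsub>G\<^esub> \<Phi>"
    and "\<psi> \<equiv> tangent_map M \<one>\<^bsub>G\<^esub> \<Psi>"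
    and "B \<equiv> tangent_map M \<one>\<^bsub>G\<^esub> \<BB>"
  shows "rota_baxter_lie_algebra real_ring (lie_algebra_of G M) \<phi> \<psi> B"
proof -
  have lie: "lie_group G M" and op: "rota_baxter_operator G \<Phi> \<Psi> \<BB>"
    and smooth: "smooth_map M M \<Phi>" "smooth_map M M \<Psi>" "smooth_map M M \<BB>"
    using assms(1) unfolding rota_baxter_lie_group_def by auto
  interpret group G using lie unfolding lie_group_def by (elim conjE)
  interpret smooth_group G M by unfold_locales (rule lie)
  have F: "\<Phi> \<one>\<^bsub>G\<^esub> = \<one>\<^bsub>G\<^esub>" "\<Phi> \<in> carrier G \<rightarrow> carrier G"
    and P: "\<Psi> \<one>\<^bsub>G\<^esub> = \<one>\<^bsub>G\<^esub>" "\<Psi> \<in> carrier G \<rightarrow> carrier G"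
    and B: "\<BB> \<in> carrier G \<rightarrow> carrier G"
    and inv: "\<And>x. x \<in> carrier G \<Longrightarrow> \<Phi> (\<Psi> x) = x"
    and rb: "\<And>a b. a \<in> carrier G \<Longrightarrow> b \<in> carrier G \<Longrightarrow> \<BB> a \<otimes>\<^bsub>G\<^esub> \<BB> b =
      \<BB> (\<Psi> (\<Phi> a \<otimes>\<^bsub>G\<^esub> \<BB> a \<otimes>\<^bsub>G\<^esub> \<Phi> b \<otimes>\<^bsub>G\<^esub> inv\<^bsub>G\<^esub> (\<BB> a)))"
    using op assms(2) unfolding rota_baxter_operator_def pair_group_def unital_pair_def by auto
  note at = smooth_at_if_smooth_map[OF _ one_topspace]
  have B1: "\<BB> \<one>\<^bsub>G\<^esub> \<in> carrier G" using B by auto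
  have "\<BB> \<one>\<^bsub>G\<^esub> \<otimes>\<^bsub>G\<^esub> \<BB> \<one>\<^bsub>G\<^esub> = \<BB> \<one>\<^bsub>G\<^esub>"
    using rb[OF one_closed one_closed] B1 by (simp add: F P)
  then have B_one: "\<BB> \<one>\<^bsub>G\<^esub> = \<one>\<^bsub>G\<^esub>" using l_cancel_one[OF B1 B1] by blast
  have pair: "pair_lie_algebra real_ring (lie_algebra_of G M) \<phi> \<psi>"
    unfolding pair_lie_algebra_def \<phi>_def \<psi>_def lie_algebra_of_simps(1)
  proof (intro conjI ballI)
    show "linear_operator real_ring (lie_algebra_of G M) (tangent_map M \<one>\<^bsub>G\<^esub> \<Phi>)"
      by (rule linear_operator_tangent_map[OF at[OF smooth(1)] F])
    show "linear_operator real_ring (lie_algebra_of G M) (tangent_map M \<one>\<^bsub>G\<^esub> \<Psi>)"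
      by (rule linear_operator_tangent_map[OF at[OF smooth(2)] P])
    show "tangent_map M \<one>\<^bsub>G\<^esub> \<Phi> (tangent_map M \<one>\<^bsub>G\<^esub> \<Psi> u) = u"
      if "u \<in> tangent_space M \<one>\<^bsub>G\<^esub>" for u
      by (rule tangent_map_right_inverse[OF at[OF smooth(1)] F(1) at[OF smooth(2)] P(1) inv that])
  qed (rule lie_algebra_lie_algebra_of)
  have lin: "linear_operator real_ring (lie_algebra_of G M) B"
    unfolding B_def by (rule linear_operator_tangent_map[OF at[OF smooth(3)] B_one B])
  show ?thesis
    unfolding rota_baxter_lie_algebra_def
  proof (rule conjI[OF pair conjI[OF lin]], intro ballI)
    fix u v assume "u \<in> carrier (lie_algebra_of G M)" "v \<in> carrier (lie_algebra_of G M)"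
    then have uv: "u \<in> tangent_space M \<one>\<^bsub>G\<^esub>" "v \<in> tangent_space M \<one>\<^bsub>G\<^esub>"
      by (simp_all only: lie_algebra_of_simps(1))
    show "lie_br (lie_algebra_of G M) (B u) (B v) =
      B (\<psi> (lie_br (lie_algebra_of G M) (B u) (\<phi> v) \<oplus>\<^bsub>lie_algebra_of G M\<^esub>
        lie_br (lie_algebra_of G M) (\<phi> u) (B v) \<oplus>\<^bsub>lie_algebra_of G M\<^esub>
        lie_br (lie_algebra_of G M) (\<phi> u) (\<phi> v)))"
      unfolding lie_algebra_of_simps(3,5) \<phi>_def \<psi>_def B_def
    proof (rule rota_baxter_identity[OF at[OF smooth(1)] F at[OF smooth(2)] P(1)
            at[OF smooth(3)] B_one B _ uv])
      show "\<BB> a \<otimes>\<^bsub>G\<^esub> \<BB> b =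
          \<BB> (\<Psi> (\<Phi> a \<otimes>\<^bsub>G\<^esub> \<BB> a \<otimes>\<^bsub>G\<^esub> \<Phi> b \<otimes>\<^bsub>G\<^esub> inv\<^bsub>G\<^esub> (\<BB> a)))"
        if "a \<in> carrier G" "b \<in> carrier G" for a b
        using that by (rule rb)
    qed
  qed
qed

end
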